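(* Let $n=3$, $p>3$ and $k>0$. Let $F_p\in C^1(\mathbb{R})$ satisfy $F_p(0)=F_p'(0)=0$ and suppose that there are constants $C>0$ and $\delta\in(0,1)$ such that $$|F_p'(u)|\le C\left(\ln\frac{1}{|u|}\right)^{1-p}\qquad\text{for all } 0<|u|<\delta .$$ Then there exists $\varepsilon_0>0$ such that, for every $\varepsilon\in\mathbb{R}$ with $|\varepsilon|<\varepsilon_0$ and every pair of initial data $(u_0,u_1)\in C^1(\mathbb{H}^3)\times C(\mathbb{H}^3)$ satisfying $$|u_0(x)|+|u_1(x)|+|\nabla u_0(x)|\le (\cosh |x|)^{-k-1}\qquad\text{for all }x\in\mathbb{H}^3,$$ the Cauchy problem $$\begin{cases}\partial_t^2u-(\Delta_{\mathbb{H}^3}+1)u=F_p(u),\\ u(0,x)=\varepsilon u_0(x),\quad u_t(0,x)=\varepsilon u_1(x),\end{cases}$$ admits a global weak solution $u\in C(\mathbb{R}\times\mathbb{H}^3)$.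
   Context: $\mathbb{H}^3$ is hyperbolic $3$-space (constant curvature $-1$) with a fixed origin $O$; in geodesic polar coordinates $(r,\omega)\in(0,\infty)\times\mathbb{S}^2$ about $O$ its metric is $dr^2+(\sinh r)^2d\omega^2$. $\Delta_{\mathbb{H}^3}$ is the Laplace–Beltrami operator, $d(x,y)$ is the geodesic distance, $|x|=d(O,x)$, and $|\nabla f|$ is the Riemannian norm of the gradient, $|\nabla f|^2=(\partial_rf)^2+|\partial_\omega f|^2/\sinh^2 r$. All functions are real-valued. For $r>0$, $M^rf(x)$ is the average of $f$ over the geodesic sphere $\{y: d(x,y)=r\}$ with respect to the induced surface measure, and $M^0f(x)=f(x)$. For continuous $g$ on $\mathbb{H}^3$ put $I(t,x,g)=\sinh t\,(M^{|t|}g)(x)$, $t\in\mathbb{R}$; this is the solution of $\partial_t^2w-(\Delta_{\mathbb{H}^3}+1)w=0$ with $w(0)=0$, $w_t(0)=g$. A (global) weak solution of the Cauchy problem is a function $u\in C(\mathbb{R}\times\mathbb{H}^3)$ satisfying the integral (Duhamel) equation $$u(t,x)=\varepsilon\big(\partial_tI(t,x,u_0)+I(t,x,u_1)\big)+\int_0^tI\big(\tau,x,F_p(u(t-\tau,\cdot))\big)\,d\tau,\qquad (t,x)\in\mathbb{R}\times\mathbb{H}^3 .$$ *)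

theory Defs
  imports "HOL-Analysis.Analysis"
begin

text \<open>
  Hyperbolic 3-space is rendered as the upper sheet of the unit hyperboloid in Minkowski space
  \<open>\<real> \<times> \<real>\<^sup>3\<close>, the time coordinate being the first one. The Riemannian metric is the restriction of the
  Minkowski form (signature \<open>(-,+,+,+)\<close>) to the tangent spaces; it has constant curvature \<open>-1\<close>.
  Functions on hyperbolic space are functions on the ambient space of which only the values on
  \<open>H3\<close> are used.
\<close>

type_synonym pt = "real \<times> (real^3)"

definition mink :: "pt \<Rightarrow> pt \<Rightarrow> real" where
  "mink v w = snd v \<bullet> snd w - fst v * fst w"

definition H3 :: "pt set" where
  "H3 = {x. mink x x = -1 \<and> fst x > 0}"

definition origin :: pt where
  "origin = (1, 0)"

definition tangent_space :: "pt \<Rightarrow> pt set" where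
  "tangent_space x = {v. mink x v = 0}"

definition riem_norm :: "pt \<Rightarrow> real" where
  "riem_norm v = sqrt (mink v v)"

definition curve_of_length :: "pt \<Rightarrow> pt \<Rightarrow> real \<Rightarrow> bool" where
  "curve_of_length x y L \<longleftrightarrow> (\<exists>\<gamma> \<gamma>'.
     (\<forall>t\<in>{0..1}. \<gamma> t \<in> H3 \<and> (\<gamma> has_vector_derivative \<gamma>' t) (at t within {0..1})) \<and>
     continuous_on {0..1} \<gamma>' \<and> \<gamma> 0 = x \<and> \<gamma> 1 = y \<and>
     L = integral {0..1} (\<lambda>t. riem_norm (\<gamma>' t)))"

definition hdist :: "pt \<Rightarrow> pt \<Rightarrow> real" where
  "hdist x y = Inf {L. curve_of_length x y L}"

text \<open>
  Secant directions of \<open>H3\<close> at \<open>x \<in> H3\<close> are tangential in the limit, so \<open>has_gradient f w x\<close> says that \<open>f\<close> is differentiable at \<open>x\<close> as a function on the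
  manifold and that the tangent vector \<open>w\<close> represents its differential.
\<close>

definition has_gradient :: "(pt \<Rightarrow> real) \<Rightarrow> pt \<Rightarrow> pt \<Rightarrow> bool" where
  "has_gradient f w x \<longleftrightarrow>
     w \<in> tangent_space x \<and> (f has_derivative (\<lambda>v. mink w v)) (at x within H3)"

definition grad :: "(pt \<Rightarrow> real) \<Rightarrow> pt \<Rightarrow> pt" where
  "grad f x = (THE w. has_gradient f w x)"

definition C1_on_H3 :: "(pt \<Rightarrow> real) \<Rightarrow> bool" where
  "C1_on_H3 f \<longleftrightarrow> (\<exists>G. (\<forall>x\<in>H3. has_gradient f (G x) x) \<and> continuous_on H3 G)"

text \<open>
  Geodesic polar coordinates about \<open>x\<close>: \<open>frame x 1\<close>, \<open>frame x 2\<close>, \<open>frame x 3\<close> is the orthonormal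
  basis of the tangent space at \<open>x\<close> that the Lorentz boost taking the origin to \<open>x\<close> makes out of
  the standard basis, and \<open>s \<mapsto> cosh s x + sinh s \<omega>\<close> is the unit speed geodesic
  starting at \<open>x\<close> in the direction of the unit tangent vector \<open>\<omega>\<close>.
\<close>

definition frame :: "pt \<Rightarrow> 3 \<Rightarrow> pt" where
  "frame x i = (snd x $ i, axis i 1 + (snd x $ i / (1 + fst x)) *\<^sub>R snd x)"

definition direction :: "pt \<Rightarrow> real \<times> real \<Rightarrow> pt" where
  "direction x = (\<lambda>(\<theta>, \<phi>). (sin \<theta> * cos \<phi>) *\<^sub>R frame x 1
     + (sin \<theta> * sin \<phi>) *\<^sub>R frame x 2 + cos \<theta> *\<^sub>R frame x 3)"

definition sphere_param :: "pt \<Rightarrow> real \<Rightarrow> real \<times> real \<Rightarrow> pt" where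
  "sphere_param x r a = cosh r *\<^sub>R x + sinh r *\<^sub>R direction x a"

text \<open>
  The area density of a parametrized surface is \<open>sqrt (E G - F\<^sup>2)\<close>, with the coefficients of the
  metric induced on the surface.
\<close>

definition area_density :: "(real \<times> real \<Rightarrow> pt) \<Rightarrow> real \<times> real \<Rightarrow> real" where
  "area_density \<Phi> = (\<lambda>(\<theta>, \<phi>).
     let v = vector_derivative (\<lambda>s. \<Phi> (s, \<phi>)) (at \<theta>);
         w = vector_derivative (\<lambda>s. \<Phi> (\<theta>, s)) (at \<phi>)
     in sqrt (mink v v * mink w w - (mink v w)\<^sup>2))"

definition sphere_integral :: "real \<Rightarrow> (pt \<Rightarrow> real) \<Rightarrow> pt \<Rightarrow> real" where
  "sphere_integral r f x = integral (cbox (0, 0) (pi, 2 * pi))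
     (\<lambda>a. f (sphere_param x r a) * area_density (sphere_param x r) a)"

definition sphere_mean :: "real \<Rightarrow> (pt \<Rightarrow> real) \<Rightarrow> pt \<Rightarrow> real" where
  "sphere_mean r f x =
     (if r = 0 then f x else sphere_integral r f x / sphere_integral r (\<lambda>_. 1) x)"

definition wave_I :: "real \<Rightarrow> pt \<Rightarrow> (pt \<Rightarrow> real) \<Rightarrow> real" where
  "wave_I t x g = sinh t * sphere_mean \<bar>t\<bar> g x"

definition global_weak_solution ::
  "(real \<Rightarrow> real) \<Rightarrow> real \<Rightarrow> (pt \<Rightarrow> real) \<Rightarrow> (pt \<Rightarrow> real) \<Rightarrow> (real \<Rightarrow> pt \<Rightarrow> real) \<Rightarrow> bool" where
  "global_weak_solution F \<epsilon> u0 u1 u \<longleftrightarrow>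
     continuous_on (UNIV \<times> H3) (\<lambda>(t, x). u t x) \<and>
     (\<forall>t. \<forall>x\<in>H3. u t x =
        \<epsilon> * (deriv (\<lambda>s. wave_I s x u0) t + wave_I t x u1)
        + (LBINT \<tau>=0..t. wave_I \<tau> x (\<lambda>y. F (u (t - \<tau>) y))))"


section \<open>Basic facts about the model\<close>

text \<open>
  The facts below are not used by the definitions. They confirm that the gradient is uniquely
  determined, that the distance is attained and has its usual closed form, and that
  \<open>sphere_param x r\<close> covers the geodesic sphere once up to a null set of parameters.
\<close>

lemma mink_simps:
  "mink (u + v) w = mink u w + mink v w" "mink w (u + v) = mink w u + mink w v"
  "mink (u - v) w = mink u w - mink v w" "mink w (u - v) = mink w u - mink w v"
  "mink (c *\<^sub>R u) w = c * mink u w" "mink w (c *\<^sub>R u) = c * mink w u"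
  "mink (- u) w = - mink u w" "mink w (- u) = - mink w u"
  by (simp_all add: mink_def inner_simps algebra_simps)

lemma mink_commute: "mink v w = mink w v"
  by (simp add: mink_def inner_commute)

lemma bounded_bilinear_mink: "bounded_bilinear mink"
proof -
  have "bilinear mink"
    unfolding bilinear_def by (intro conjI allI linearI) (simp_all add: mink_simps)
  then show ?thesis
    by (simp add: bilinear_conv_bounded_bilinear)
qed

lemmas mink_derivative_intros [derivative_intros] =
  bounded_bilinear.FDERIV[OF bounded_bilinear_mink]
  bounded_bilinear.has_vector_derivative[OF bounded_bilinear_mink]
lemmas mink_continuous_intros [continuous_intros] =
  bounded_bilinear.continuous_on[OF bounded_bilinear_mink]

lemma H3_fst_sq: "x \<in> H3 \<Longrightarrow> (fst x)\<^sup>2 = 1 + (norm (snd x))\<^sup>2"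
  by (simp add: H3_def mink_def power2_norm_eq_inner) (simp add: power2_eq_square)

lemma tangent_bound:
  assumes "x \<in> H3" "v \<in> tangent_space x"
  shows "(norm (snd v))\<^sup>2 \<le> (1 + (norm (snd x))\<^sup>2) * mink v v"
proof -
  have "snd x \<bullet> snd v = fst x * fst v"
    using assms by (simp add: tangent_space_def mink_def)
  then have "(fst x * fst v)\<^sup>2 \<le> (norm (snd x))\<^sup>2 * (norm (snd v))\<^sup>2"
    by (metis Cauchy_Schwarz_ineq power2_norm_eq_inner)
  then show ?thesis
    using H3_fst_sq[OF assms(1)]
    by (simp add: mink_def power_mult_distrib power2_norm_eq_inner algebra_simps
        flip: power2_eq_square)
qed

lemma tangent_nonneg:
  assumes "x \<in> H3" "v \<in> tangent_space x"
  shows "mink v v \<ge> 0"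
proof -
  have "0 \<le> (1 + (norm (snd x))\<^sup>2) * mink v v"
    using tangent_bound[OF assms] order_trans zero_le_power2 by blast
  moreover have "1 + (norm (snd x))\<^sup>2 > 0"
    by (simp add: add_pos_nonneg)
  ultimately show ?thesis
    by (simp add: zero_le_mult_iff)
qed

lemma tangent_definite:
  assumes "x \<in> H3" "v \<in> tangent_space x" "mink v v = 0"
  shows "v = 0"
proof -
  have "snd v = 0"
    using tangent_bound[OF assms(1,2)] assms(3) by simp
  then show ?thesis
    using assms(3) by (simp add: mink_def prod_eq_iff)
qed

lemma tangent_Cauchy_Schwarz:
  assumes x: "x \<in> H3" and v: "v \<in> tangent_space x" and w: "w \<in> tangent_space x"
  shows "\<bar>mink v w\<bar> \<le> riem_norm v * riem_norm w"
proof -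
  let ?p = "mink w w" and ?q = "mink v w"
  have "(mink v w)\<^sup>2 \<le> mink v v * ?p"
  proof (cases "?p = 0")
    case True
    then have "w = 0"
      using tangent_definite x w by blast
    then show ?thesis by (simp add: mink_def)
  next
    case False
    then have p: "?p > 0"
      using tangent_nonneg[OF x w] by simp
    have "?p *\<^sub>R v - ?q *\<^sub>R w \<in> tangent_space x"
      using v w by (simp add: tangent_space_def mink_simps)
    from tangent_nonneg[OF x this] have "0 \<le> ?p * (mink v v * ?p - ?q\<^sup>2)"
      by (simp add: mink_simps mink_commute[of w v] algebra_simps power2_eq_square)
    then show ?thesis
      using p by (simp add: zero_le_mult_iff)
  qed
  then show ?thesis
    using real_sqrt_le_mono by (fastforce simp: riem_norm_def real_sqrt_mult)
qed

lemma mink_le_minus_1: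
  assumes "x \<in> H3" "y \<in> H3"
  shows "- mink x y \<ge> 1"
proof -
  let ?a = "norm (snd x)" and ?b = "norm (snd y)"
  have "(1 + ?a * ?b)\<^sup>2 \<le> (fst x * fst y)\<^sup>2"
    using sum_squares_bound[of ?a ?b]
    by (simp add: power_mult_distrib H3_fst_sq assms) (simp add: power2_eq_square algebra_simps)
  moreover have "0 \<le> fst x * fst y"
    using assms by (simp add: H3_def)
  ultimately have "1 + ?a * ?b \<le> fst x * fst y"
    using power2_le_imp_le by blast
  moreover have "snd x \<bullet> snd y \<le> ?a * ?b"
    by (rule norm_cauchy_schwarz)
  ultimately show ?thesis
    by (simp add: mink_def)
qed

lemma H3I:
  assumes "x \<in> H3" "mink z z = -1" "mink x z < 0"
  shows "z \<in> H3"
proof (rule ccontr)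
  assume "z \<notin> H3"
  moreover have "fst z \<noteq> 0"
    using assms(2) inner_ge_zero[of "snd z"] by (auto simp: mink_def simp del: inner_ge_zero)
  ultimately have "- z \<in> H3"
    using assms(2) by (auto simp: H3_def mink_simps)
  from mink_le_minus_1[OF assms(1) this] show False
    using assms(3) by (simp add: mink_simps)
qed

lemma geodesic_in_H3:
  assumes x: "x \<in> H3" and v: "v \<in> tangent_space x" and n: "mink v v = 1"
  shows "cosh s *\<^sub>R x + sinh s *\<^sub>R v \<in> H3"
    and "mink x (cosh s *\<^sub>R x + sinh s *\<^sub>R v) = - cosh s"
proof -
  have *: "mink x x = -1" "mink x v = 0" "mink v x = 0"
    using x v by (auto simp: H3_def tangent_space_def mink_commute)
  then show 2: "mink x (cosh s *\<^sub>R x + sinh s *\<^sub>R v) = - cosh s"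
    by (simp add: mink_simps)
  show "cosh s *\<^sub>R x + sinh s *\<^sub>R v \<in> H3"
  proof (rule H3I[OF x])
    show "mink (cosh s *\<^sub>R x + sinh s *\<^sub>R v) (cosh s *\<^sub>R x + sinh s *\<^sub>R v) = -1"
      using * n hyperbolic_pythagoras[of s] by (simp add: mink_simps power2_eq_square)
  qed (simp add: 2 cosh_real_pos)
qed

lemma direction_to_point:
  assumes x: "x \<in> H3" and y: "y \<in> H3" and c: "- mink x y = cosh r" and r: "r > 0"
  obtains w where "w \<in> tangent_space x" "mink w w = 1" "y = cosh r *\<^sub>R x + sinh r *\<^sub>R w"
proof
  let ?w = "(1 / sinh r) *\<^sub>R (y - cosh r *\<^sub>R x)"
  have s: "sinh r > 0" using r by simp
  have xy: "mink x x = -1" "mink y y = -1" "mink x y = - cosh r" "mink y x = - cosh r"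
    using x y c by (auto simp: H3_def mink_commute)
  show "?w \<in> tangent_space x"
    using xy by (simp add: tangent_space_def mink_simps)
  have "mink ?w ?w = (cosh r * cosh r - 1) / (sinh r * sinh r)"
    using xy by (simp add: mink_simps)
  also have "cosh r * cosh r - 1 = sinh r * sinh r"
    using hyperbolic_pythagoras[of r] by (simp add: power2_eq_square)
  finally show "mink ?w ?w = 1"
    using s by simp
  show "y = cosh r *\<^sub>R x + sinh r *\<^sub>R ?w"
    using s by simp
qed

lemma mink_eq_minus_1:
  assumes x: "x \<in> H3" and y: "y \<in> H3" and "- mink x y = 1"
  shows "y = x"
proof -
  have xy: "mink x x = -1" "mink y y = -1" "mink x y = -1" "mink y x = -1"
    using assms mink_commute[of x y] by (auto simp: H3_def)
  have "y - x \<in> tangent_space x" "mink (y - x) (y - x) = 0"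
    using xy by (simp_all add: tangent_space_def mink_simps)
  from tangent_definite[OF x this] show ?thesis by simp
qed

section \<open>The gradient is well defined\<close>

lemma has_gradient_unique:
  assumes x: "x \<in> H3" and w: "has_gradient f w x" "has_gradient f w' x"
  shows "w = w'"
proof (rule ccontr)
  assume ne: "w \<noteq> w'"
  let ?d = "w - w'"
  have d: "?d \<in> tangent_space x"
    using w by (simp add: has_gradient_def tangent_space_def mink_simps)
  then have pos: "mink ?d ?d > 0"
    using tangent_nonneg tangent_definite x ne by (metis eq_iff_diff_eq_0 less_eq_real_def)
  define v where "v = (1 / riem_norm ?d) *\<^sub>R ?d"
  have v: "v \<in> tangent_space x"
    using d by (simp add: v_def tangent_space_def mink_simps)
  have n: "mink v v = 1"
    using pos by (simp add: v_def mink_simps(5,6) riem_norm_def)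
  define \<gamma> where "\<gamma> = (\<lambda>s. cosh s *\<^sub>R x + sinh s *\<^sub>R v)"
  have \<gamma>: "(\<gamma> has_derivative (\<lambda>h. h *\<^sub>R v)) (at 0)"
    unfolding \<gamma>_def by (auto intro!: derivative_eq_intros)
  have \<gamma>_H3: "range \<gamma> \<subseteq> H3"
    using geodesic_in_H3(1)[OF x v n] by (auto simp: \<gamma>_def)
  have comp: "((\<lambda>s. f (\<gamma> s)) has_derivative (\<lambda>h. mink u (h *\<^sub>R v))) (at 0)"
    if "has_gradient f u x" for u
    using has_derivative_in_compose[of \<gamma> "\<lambda>h. h *\<^sub>R v" 0 UNIV f "mink u"] \<gamma> that \<gamma>_H3
    by (auto simp: has_gradient_def \<gamma>_def intro: has_derivative_subset)
  have "mink w v = mink w' v"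
    using has_derivative_unique[OF comp[OF w(1)] comp[OF w(2)]]
    by (auto dest: fun_cong[of _ _ 1])
  then have "mink ?d v = 0"
    by (simp add: mink_simps(3))
  then show False
    using pos by (simp add: v_def mink_simps(6) riem_norm_def)
qed

lemma grad_eqI:
  assumes "x \<in> H3" "has_gradient f w x"
  shows "grad f x = w"
  unfolding grad_def using assms has_gradient_unique by blast

section \<open>The geodesic distance\<close>

lemma curve_of_length_ge:
  assumes "curve_of_length x y L"
  shows "arcosh (- mink x y) \<le> L"
proof -
  from assms obtain \<gamma> \<gamma>' where
        \<gamma>_H3: "\<And>t. t \<in> {0..1} \<Longrightarrow> \<gamma> t \<in> H3"
    and \<gamma>': "\<And>t. t \<in> {0..1} \<Longrightarrow> (\<gamma> has_vector_derivative \<gamma>' t) (at t within {0..1})"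
    and cont': "continuous_on {0..1} \<gamma>'"
    and ends: "\<gamma> 0 = x" "\<gamma> 1 = y"
    and L: "L = integral {0..1} (\<lambda>t. riem_norm (\<gamma>' t))"
    unfolding curve_of_length_def by blast
  have x: "x \<in> H3" and y: "y \<in> H3"
    using \<gamma>_H3[of 0] \<gamma>_H3[of 1] ends by auto
  have cont\<gamma>: "continuous_on {0..1} \<gamma>"
    using \<gamma>' has_vector_derivative_continuous continuous_on_eq_continuous_within by blast
  define c where "c = (\<lambda>t. - mink x (\<gamma> t))"
  have c_ge: "c t \<ge> 1" if "t \<in> {0..1}" for t
    using mink_le_minus_1[OF x \<gamma>_H3[OF that]] by (simp add: c_def)
  have contc: "continuous_on {0..1} c"
    unfolding c_def by (intro continuous_intros cont\<gamma>)
  have c0: "c 0 = 1"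
    using x ends by (simp add: c_def H3_def)
  have c': "(c has_real_derivative - mink x (\<gamma>' t)) (at t)" if t: "0 < t" "t < 1" for t
  proof -
    have "(\<gamma> has_vector_derivative \<gamma>' t) (at t)"
      using \<gamma>'[of t] t at_within_interior[of t "{0..1}"] by auto
    then have "((\<lambda>s. mink x (\<gamma> s)) has_vector_derivative mink x (\<gamma>' t)) (at t)"
      using bounded_linear.has_vector_derivative
        [OF bounded_bilinear.bounded_linear_right[OF bounded_bilinear_mink]] by blast
    then show ?thesis
      unfolding c_def has_real_derivative_iff_has_vector_derivative
      by (rule has_vector_derivative_minus)
  qed
  have tang: "\<gamma>' t \<in> tangent_space (\<gamma> t)" if t: "0 < t" "t < 1" for t
  proof -
    have d: "(\<gamma> has_vector_derivative \<gamma>' t) (at t)"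
      using \<gamma>'[of t] t at_within_interior[of t "{0..1}"] by auto
    have "((\<lambda>s. mink (\<gamma> s) (\<gamma> s)) has_vector_derivative 2 * mink (\<gamma> t) (\<gamma>' t)) (at t)"
      by (rule derivative_eq_intros d)+ (simp add: mink_commute)
    moreover have "((\<lambda>s. mink (\<gamma> s) (\<gamma> s)) has_vector_derivative 0) (at t)"
    proof (rule has_vector_derivative_transform_within_open)
      show "((\<lambda>s. -1 :: real) has_vector_derivative 0) (at t)" by simp
      show "open {0<..<1 :: real}" "t \<in> {0<..<1}" using t by auto
      show "-1 = mink (\<gamma> s) (\<gamma> s)" if "s \<in> {0<..<1}" for s
        using \<gamma>_H3[of s] that by (simp add: H3_def)
    qed
    ultimately have "2 * mink (\<gamma> t) (\<gamma>' t) = 0"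
      by (rule vector_derivative_unique_at)
    then show ?thesis by (simp add: tangent_space_def)
  qed
  have speed: "\<bar>mink x (\<gamma>' t)\<bar> \<le> sqrt ((c t)\<^sup>2 - 1) * riem_norm (\<gamma>' t)" if t: "0 < t" "t < 1" for t
  proof -
    have g: "\<gamma> t \<in> H3" using \<gamma>_H3 t by simp
    let ?w = "x - c t *\<^sub>R \<gamma> t"
    have m: "mink x x = -1" "mink (\<gamma> t) (\<gamma> t) = -1" "mink x (\<gamma> t) = - c t" "mink (\<gamma> t) x = - c t"
      using x g by (auto simp: c_def H3_def mink_commute)
    have w: "?w \<in> tangent_space (\<gamma> t)"
      using m by (simp add: tangent_space_def mink_simps)
    have "mink ?w (\<gamma>' t) = mink x (\<gamma>' t)"
      using tang[OF t] by (simp add: tangent_space_def mink_simps)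
    moreover have "riem_norm ?w = sqrt ((c t)\<^sup>2 - 1)"
      using m by (simp add: riem_norm_def mink_simps power2_eq_square algebra_simps)
    ultimately show ?thesis
      using tangent_Cauchy_Schwarz[OF g w tang[OF t]] by simp
  qed
  have contn: "continuous_on {0..1} (\<lambda>t. riem_norm (\<gamma>' t))"
    unfolding riem_norm_def by (intro continuous_intros cont')
  define S where "S = (\<lambda>t. integral {0..t} (\<lambda>s. riem_norm (\<gamma>' s)))"
  have S': "(S has_real_derivative riem_norm (\<gamma>' t)) (at t)" if t: "0 < t" "t < 1" for t
    using integral_has_real_derivative[OF contn, of t] t at_within_interior[of t "{0..1}"]
    by (auto simp: S_def)
  have contS: "continuous_on {0..1} S"
    unfolding S_def by (intro indefinite_integral_continuous_1 integrable_continuous_real contn)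
  have norm_nonneg: "riem_norm (\<gamma>' t) \<ge> 0" if "0 < t" "t < 1" for t
    using tangent_nonneg[OF \<gamma>_H3 tang] that by (simp add: riem_norm_def)
  have S_mono: "S 0 \<le> S t" if "t \<in> {0..1}" for t
  proof (rule DERIV_nonneg_imp_increasing_open[where f = S])
    show "0 \<le> t" using that by simp
    show "\<exists>y. DERIV S s :> y \<and> 0 \<le> y" if "0 < s" "s < t" for s
      using S'[of s] norm_nonneg[of s] that \<open>t \<in> {0..1}\<close> by auto
    show "continuous_on {0..t} S"
      using contS that continuous_on_subset by fastforce
  qed
  have "closed {t \<in> {0..1}. c t = 1}"
    by (rule continuous_closed_preimage_constant[OF contc closed_atLeastAtMost])
  moreover have "bounded {t \<in> {0..1}. c t = 1}"
    by (rule bounded_subset[OF bounded_closed_interval[of 0 1]]) auto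
  ultimately have "compact {t \<in> {0..1}. c t = 1}"
    by (simp add: compact_eq_bounded_closed)
  then obtain a where a: "a \<in> {0..1}" "c a = 1" and a_max: "\<And>t. t \<in> {0..1} \<Longrightarrow> c t = 1 \<Longrightarrow> t \<le> a"
    using compact_attains_sup[of "{t \<in> {0..1}. c t = 1}"] c0 by force
  let ?h = "\<lambda>t. S t - arcosh (c t)"
  have "?h a \<le> ?h 1"
  proof (rule DERIV_nonneg_imp_increasing_open[where f = ?h])
    show "a \<le> 1" using a by simp
    show "continuous_on {a..1} ?h"
      using a c_ge by (intro continuous_intros continuous_on_subset[OF contS] continuous_on_subset[OF contc]) auto
    fix t assume t: "a < t" "t < 1"
    then have t0: "0 < t" "t \<in> {0..1}" using a by auto
    have c1: "c t > 1"
      using c_ge[OF t0(2)] a_max[OF t0(2)] t by force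
    then have pos: "sqrt ((c t)\<^sup>2 - 1) > 0"
      by (simp add: one_less_power)
    have "(?h has_real_derivative riem_norm (\<gamma>' t) - (1 / sqrt ((c t)\<^sup>2 - 1)) * (- mink x (\<gamma>' t))) (at t)"
      by (intro DERIV_diff S' DERIV_chain2[OF arcosh_real_has_field_derivative] c' c1 t0 t)
    moreover have "riem_norm (\<gamma>' t) - (1 / sqrt ((c t)\<^sup>2 - 1)) * (- mink x (\<gamma>' t)) \<ge> 0"
      using speed[OF t0(1) t(2)] pos by (simp add: field_simps)
    ultimately show "\<exists>y. DERIV ?h t :> y \<and> 0 \<le> y" by blast
  qed
  then have "S a + arcosh (c 1) \<le> S 1"
    using a by simp
  moreover have "S 0 = 0" "S 1 = L" "c 1 = - mink x y"
    by (simp_all add: S_def L c_def ends)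
  ultimately show ?thesis
    using S_mono[OF a(1)] by simp
qed

lemma geodesic_length:
  assumes x: "x \<in> H3" and y: "y \<in> H3"
  shows "curve_of_length x y (arcosh (- mink x y))"
proof (cases "- mink x y = 1")
  case True
  then have "y = x" using mink_eq_minus_1 x y by blast
  then show ?thesis
    using x unfolding curve_of_length_def
    by (intro exI[of _ "\<lambda>_. x"] exI[of _ "\<lambda>_. 0"]) (auto simp: H3_def riem_norm_def mink_def)
next
  case False
  define r where "r = arcosh (- mink x y)"
  have "- mink x y > 1"
    using False mink_le_minus_1[OF x y] by simp
  then have r: "r > 0" "cosh r = - mink x y"
    by (simp_all add: r_def)
  then obtain w where w: "w \<in> tangent_space x" "mink w w = 1" "y = cosh r *\<^sub>R x + sinh r *\<^sub>R w"
    using direction_to_point[OF x y] by metis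
  define \<gamma> where "\<gamma> = (\<lambda>t. cosh (t * r) *\<^sub>R x + sinh (t * r) *\<^sub>R w)"
  define \<gamma>' where "\<gamma>' = (\<lambda>t. (r * sinh (t * r)) *\<^sub>R x + (r * cosh (t * r)) *\<^sub>R w)"
  have m: "mink x x = -1" "mink x w = 0" "mink w x = 0"
    using x w by (auto simp: H3_def tangent_space_def mink_commute)
  have "riem_norm (\<gamma>' t) = r" for t
  proof -
    have "mink (\<gamma>' t) (\<gamma>' t) = r\<^sup>2 * ((cosh (t * r))\<^sup>2 - (sinh (t * r))\<^sup>2)"
      using m w(2) by (simp add: \<gamma>'_def mink_simps power2_eq_square algebra_simps)
    also have "\<dots> = r\<^sup>2"
      by (simp add: hyperbolic_pythagoras)
    finally show ?thesis using r by (simp add: riem_norm_def)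
  qed
  then have "r = integral {0..1} (\<lambda>t. riem_norm (\<gamma>' t))"
    by simp
  moreover have "\<gamma> t \<in> H3" for t
    using geodesic_in_H3(1)[OF x w(1,2)] by (simp add: \<gamma>_def)
  moreover have "(\<gamma> has_vector_derivative \<gamma>' t) (at t within {0..1})" for t
    unfolding \<gamma>_def \<gamma>'_def by (auto intro!: derivative_eq_intros simp: algebra_simps)
  moreover have "continuous_on {0..1} \<gamma>'"
    unfolding \<gamma>'_def by (intro continuous_intros)
  moreover have "\<gamma> 0 = x" "\<gamma> 1 = y"
    by (simp_all add: \<gamma>_def w)
  ultimately show ?thesis
    unfolding curve_of_length_def r_def[symmetric] by blast
qed

theorem hdist_eq:
  assumes "x \<in> H3" "y \<in> H3"
  shows "hdist x y = arcosh (- mink x y)"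
  unfolding hdist_def
  by (rule cInf_eq_minimum) (use assms geodesic_length curve_of_length_ge in auto)

lemma cosh_hdist:
  assumes "x \<in> H3" "y \<in> H3"
  shows "cosh (hdist x y) = - mink x y"
  using mink_le_minus_1[OF assms] by (simp add: hdist_eq assms)

section \<open>Geodesic spheres\<close>

lemma frame_tangent:
  assumes "x \<in> H3"
  shows "frame x i \<in> tangent_space x"
proof -
  have "snd x \<bullet> snd x = (fst x - 1) * (1 + fst x)" "1 + fst x \<noteq> 0"
    using assms by (auto simp: H3_def mink_def algebra_simps)
  then have "(snd x \<bullet> snd x) / (1 + fst x) = fst x - 1"
    by simp
  then have "snd x $ i * (snd x \<bullet> snd x) / (1 + fst x) = snd x $ i * (fst x - 1)"
    by (metis times_divide_eq_right)
  then show ?thesis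
    by (simp add: tangent_space_def mink_def frame_def inner_simps inner_axis algebra_simps)
qed

lemma frame_orthonormal:
  assumes "x \<in> H3"
  shows "mink (frame x i) (frame x j) = (if i = j then 1 else 0)"
proof -
  have *: "snd x \<bullet> snd x = (fst x - 1) * (1 + fst x)" "1 + fst x \<noteq> 0"
    using assms by (auto simp: H3_def mink_def algebra_simps)
  let ?i = "snd x $ i" and ?j = "snd x $ j" and ?s = "1 + fst x"
  have "mink (frame x i) (frame x j) =
      axis i 1 \<bullet> (axis j 1 :: real^3) + 2 * ?i * ?j / ?s + ?i * ?j * (snd x \<bullet> snd x) / (?s * ?s) - ?i * ?j"
    by (simp add: mink_def frame_def inner_simps inner_axis inner_axis' inner_commute mult_ac)
  also have "\<dots> = axis i 1 \<bullet> (axis j 1 :: real^3)"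
  proof -
    have "?i * ?j * (snd x \<bullet> snd x) / (?s * ?s) = ?i * ?j * (fst x - 1) / ?s"
      using *(2) unfolding *(1) by simp
    moreover have "2 * ?i * ?j / ?s + ?i * ?j * (fst x - 1) / ?s = ?i * ?j"
      using *(2) by (simp add: add_divide_distrib[symmetric]) (simp add: field_simps)
    ultimately show ?thesis by simp
  qed
  finally show ?thesis
    by (simp add: inner_axis_axis)
qed

lemma frame_expansion:
  assumes x: "x \<in> H3" and w: "w \<in> tangent_space x"
  shows "w = (\<Sum>i\<in>UNIV. mink w (frame x i) *\<^sub>R frame x i)"
proof -
  define a where "a = snd w - (fst w / (1 + fst x)) *\<^sub>R snd x"
  have *: "snd x \<bullet> snd x = (fst x - 1) * (1 + fst x)" "1 + fst x \<noteq> 0"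
    using assms by (auto simp: H3_def mink_def algebra_simps)
  have wx: "snd w \<bullet> snd x = fst w * fst x"
    using w by (simp add: tangent_space_def mink_def inner_commute)
  have coeff: "mink w (frame x i) = a $ i" for i
  proof -
    have "mink w (frame x i) = snd w $ i + snd x $ i / (1 + fst x) * (snd w \<bullet> snd x) - fst w * snd x $ i"
      by (simp add: mink_def frame_def inner_simps inner_axis)
    also have "\<dots> = a $ i"
      using *(2) by (simp add: wx a_def field_simps)
    finally show ?thesis .
  qed
  have ax: "a \<bullet> snd x = fst w"
    using *(2) by (simp add: a_def inner_simps wx *(1) field_simps)
  have "(\<Sum>i\<in>UNIV. a $ i *\<^sub>R frame x i) = (a \<bullet> snd x, a + ((a \<bullet> snd x) / (1 + fst x)) *\<^sub>R snd x)"
  proof (rule prod_eqI)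
    show "fst (\<Sum>i\<in>UNIV. a $ i *\<^sub>R frame x i)
        = fst (a \<bullet> snd x, a + ((a \<bullet> snd x) / (1 + fst x)) *\<^sub>R snd x)"
      by (simp add: fst_sum frame_def inner_vec_def)
    have 1: "(\<Sum>i\<in>UNIV. a $ i *\<^sub>R axis i 1) = a"
      using basis_expansion[of a] by (simp add: scalar_mult_eq_scaleR)
    have 2: "(a \<bullet> snd x) / (1 + fst x) = (\<Sum>i\<in>UNIV. a $ i * snd x $ i / (1 + fst x))"
      by (simp add: inner_vec_def sum_divide_distrib)
    show "snd (\<Sum>i\<in>UNIV. a $ i *\<^sub>R frame x i)
        = snd (a \<bullet> snd x, a + ((a \<bullet> snd x) / (1 + fst x)) *\<^sub>R snd x)"
      by (simp add: snd_sum frame_def scaleR_add_right sum.distrib 1 2 scaleR_sum_left)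
  qed
  also have "\<dots> = w"
    by (simp add: ax prod_eq_iff) (simp add: a_def)
  finally show ?thesis
    by (simp add: coeff)
qed

lemma mink_direction_frame:
  assumes "x \<in> H3"
  shows "mink (direction x (\<theta>, \<phi>)) (frame x 1) = sin \<theta> * cos \<phi>"
    "mink (direction x (\<theta>, \<phi>)) (frame x 2) = sin \<theta> * sin \<phi>"
    "mink (direction x (\<theta>, \<phi>)) (frame x 3) = cos \<theta>"
  by (simp_all add: direction_def mink_simps frame_orthonormal assms)

lemma direction_unit:
  assumes "x \<in> H3"
  shows "direction x a \<in> tangent_space x" "mink (direction x a) (direction x a) = 1"
proof -
  obtain \<theta> \<phi> where a: "a = (\<theta>, \<phi>)" by (cases a)
  show "direction x a \<in> tangent_space x"
    using frame_tangent[OF assms] by (simp add: a direction_def tangent_space_def mink_simps)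
  have "mink (direction x a) (direction x a)
      = (sin \<theta>)\<^sup>2 * ((cos \<phi>)\<^sup>2 + (sin \<phi>)\<^sup>2) + (cos \<theta>)\<^sup>2"
    unfolding a direction_def case_prod_conv
    by (simp add: mink_simps frame_orthonormal assms del: sin_cos_squared_add sin_cos_squared_add2)
      (simp add: power2_eq_square algebra_simps del: sin_cos_squared_add3)
  then show "mink (direction x a) (direction x a) = 1"
    by simp
qed

theorem sphere_param_image:
  assumes x: "x \<in> H3" and r: "r > 0"
  shows "sphere_param x r ` cbox (0, 0) (pi, 2 * pi) = {y \<in> H3. hdist x y = r}"
proof (intro subset_antisym subsetI)
  fix y assume "y \<in> sphere_param x r ` cbox (0, 0) (pi, 2 * pi)"
  then obtain a where y: "y = sphere_param x r a" by blast
  have "y \<in> H3" "mink x y = - cosh r"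
    using geodesic_in_H3[OF x direction_unit[OF x]] by (simp_all add: y sphere_param_def)
  then show "y \<in> {y \<in> H3. hdist x y = r}"
    using r x by (simp add: hdist_eq arcosh_cosh_real)
next
  fix y assume "y \<in> {y \<in> H3. hdist x y = r}"
  then have y: "y \<in> H3" "- mink x y = cosh r"
    using cosh_hdist[OF x, of y] by auto
  then obtain w where w: "w \<in> tangent_space x" "mink w w = 1" "y = cosh r *\<^sub>R x + sinh r *\<^sub>R w"
    using direction_to_point[OF x _ _ r] by blast
  define a where "a = (\<lambda>i. mink w (frame x i))"
  have wa: "w = a 1 *\<^sub>R frame x 1 + a 2 *\<^sub>R frame x 2 + a 3 *\<^sub>R frame x 3"
    using frame_expansion[OF x w(1)] by (simp add: a_def sum_3)
  have "mink w w = (a 1)\<^sup>2 + (a 2)\<^sup>2 + (a 3)\<^sup>2"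
    by (subst (1 2) wa) (simp add: mink_simps frame_orthonormal x power2_eq_square)
  then have a1: "(a 1)\<^sup>2 + (a 2)\<^sup>2 + (a 3)\<^sup>2 = 1"
    using w(2) by simp
  then have "(a 3)\<^sup>2 \<le> 1"
    by (smt (verit) zero_le_power2)
  then have a3: "-1 \<le> a 3" "a 3 \<le> 1"
    by (simp_all add: abs_le_iff abs_square_le_1)
  define \<theta> where "\<theta> = arccos (a 3)"
  have \<theta>: "cos \<theta> = a 3" "0 \<le> \<theta>" "\<theta> \<le> pi"
    using a3 by (simp_all add: \<theta>_def arccos_lbound arccos_ubound)
  have sin2: "(a 1)\<^sup>2 + (a 2)\<^sup>2 = (sin \<theta>)\<^sup>2"
    using a1 \<theta>(1) sin_squared_eq[of \<theta>] by simp
  obtain \<phi> where \<phi>: "0 \<le> \<phi>" "\<phi> \<le> 2 * pi" "a 1 = sin \<theta> * cos \<phi>" "a 2 = sin \<theta> * sin \<phi>"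
  proof (cases "sin \<theta> = 0")
    case True
    then have "a 1 = 0" "a 2 = 0" using sin2 by (simp_all add: sum_power2_eq_zero_iff)
    then show ?thesis using that[of 0] True by simp
  next
    case False
    have "(a 1 / sin \<theta>)\<^sup>2 + (a 2 / sin \<theta>)\<^sup>2 = 1"
      using False sin2 by (simp add: power_divide flip: add_divide_distrib)
    then obtain t where "0 \<le> t" "t < 2 * pi" "a 1 / sin \<theta> = cos t" "a 2 / sin \<theta> = sin t"
      by (rule sincos_total_2pi)
    then show ?thesis
      using False that[of t] by (simp add: field_simps)
  qed
  have "direction x (\<theta>, \<phi>) = w"
    by (subst wa) (simp add: direction_def \<theta>(1) \<phi>(3,4))
  then have "y = sphere_param x r (\<theta>, \<phi>)"
    by (simp add: sphere_param_def w(3))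
  then show "y \<in> sphere_param x r ` cbox (0, 0) (pi, 2 * pi)"
    using \<theta> \<phi> by (auto simp: cbox_Pair_eq)
qed

lemma sphere_param_inj:
  assumes x: "x \<in> H3" and r: "r > 0"
  shows "inj_on (sphere_param x r) ({0<..<pi} \<times> {0..<2 * pi})"
proof (rule inj_onI)
  fix a a' assume *: "a \<in> {0<..<pi} \<times> {0..<2 * pi}" "a' \<in> {0<..<pi} \<times> {0..<2 * pi}"
    "sphere_param x r a = sphere_param x r a'"
  obtain \<theta> \<phi> \<theta>' \<phi>' where a: "a = (\<theta>, \<phi>)" "a' = (\<theta>', \<phi>')"
    by (metis surj_pair)
  then have i: "\<theta> \<in> {0<..<pi}" "\<phi> \<in> {0..<2 * pi}" "\<theta>' \<in> {0<..<pi}" "\<phi>' \<in> {0..<2 * pi}"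
    using * by auto
  have d: "direction x (\<theta>, \<phi>) = direction x (\<theta>', \<phi>')"
    using r * a by (simp add: sphere_param_def)
  have "cos \<theta> = cos \<theta>'"
    using mink_direction_frame(3)[OF x] d by metis
  then have \<theta>: "\<theta> = \<theta>'"
    using i cos_inj_pi by simp
  have "sin \<theta> \<noteq> 0"
    using i sin_gt_zero by force
  then have "cos \<phi> = cos \<phi>'" "sin \<phi> = sin \<phi>'"
    using mink_direction_frame(1,2)[OF x] d \<theta> by (metis mult_left_cancel)+
  then have "\<phi> = \<phi>'"
  proof -
    obtain n :: int where n: "\<phi> = \<phi>' + 2 * pi * n"
      using \<open>cos \<phi> = cos \<phi>'\<close> \<open>sin \<phi> = sin \<phi>'\<close> sin_cos_eq_iff by metis
    then have "\<bar>2 * pi * n\<bar> < 2 * pi * 1"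
      using i by auto
    then have "\<bar>real_of_int n\<bar> < 1"
      by (simp add: abs_mult)
    then show ?thesis using n by simp
  qed
  with \<theta> show "a = a'" by (simp add: a)
qed

theorem area_density_sphere:
  assumes x: "x \<in> H3"
  shows "area_density (sphere_param x r) (\<theta>, \<phi>) = (sinh r)\<^sup>2 * \<bar>sin \<theta>\<bar>"
proof -
  let ?v = "sinh r *\<^sub>R ((cos \<theta> * cos \<phi>) *\<^sub>R frame x 1 + (cos \<theta> * sin \<phi>) *\<^sub>R frame x 2
     - sin \<theta> *\<^sub>R frame x 3)"
  let ?w = "sinh r *\<^sub>R ((- sin \<theta> * sin \<phi>) *\<^sub>R frame x 1 + (sin \<theta> * cos \<phi>) *\<^sub>R frame x 2)"
  have v: "vector_derivative (\<lambda>s. sphere_param x r (s, \<phi>)) (at \<theta>) = ?v"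
    unfolding sphere_param_def direction_def
    by (rule vector_derivative_at) (auto intro!: derivative_eq_intros simp: algebra_simps)
  have w: "vector_derivative (\<lambda>s. sphere_param x r (\<theta>, s)) (at \<phi>) = ?w"
    unfolding sphere_param_def direction_def
    by (rule vector_derivative_at) (auto intro!: derivative_eq_intros simp: algebra_simps)
  have "mink ?v ?v = (sinh r)\<^sup>2 * ((cos \<theta>)\<^sup>2 * ((cos \<phi>)\<^sup>2 + (sin \<phi>)\<^sup>2) + (sin \<theta>)\<^sup>2)"
    by (simp add: mink_simps frame_orthonormal x del: sin_cos_squared_add sin_cos_squared_add2)
      (simp add: power2_eq_square algebra_simps del: sin_cos_squared_add3)
  then have E: "mink ?v ?v = (sinh r)\<^sup>2"
    by simp
  have "mink ?w ?w = (sinh r)\<^sup>2 * (sin \<theta>)\<^sup>2 * ((cos \<phi>)\<^sup>2 + (sin \<phi>)\<^sup>2)"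
    by (simp add: mink_simps frame_orthonormal x del: sin_cos_squared_add sin_cos_squared_add2)
      (simp add: power2_eq_square algebra_simps del: sin_cos_squared_add3)
  then have G: "mink ?w ?w = (sinh r)\<^sup>2 * (sin \<theta>)\<^sup>2"
    by simp
  have F: "mink ?v ?w = 0"
    by (simp add: mink_simps frame_orthonormal x)
  have "(sinh r)\<^sup>2 * ((sinh r)\<^sup>2 * (sin \<theta>)\<^sup>2) - 0\<^sup>2 = ((sinh r)\<^sup>2 * \<bar>sin \<theta>\<bar>)\<^sup>2"
    by (simp add: power_mult_distrib)
  then show ?thesis
    unfolding area_density_def case_prod_conv Let_def v w E F G by simp
qed

end

theory Submission
  imports Defs
begin

text \<open>
  Put \<open>K x = (1 + \<bar>x\<bar>) powr - a\<close> with \<open>a = (p + 1) / 4\<close>, so that \<open>a > 1\<close> and \<open>2 a < p - 1\<close>; this is where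
  \<open>p > 3\<close> enters. On \<open>H3\<close> we have \<open>fst x = cosh \<bar>x\<bar>\<close>, and the solution is a fixed point of the Duhamel
  map in the ball of functions bounded by \<open>\<eta>\<close> times the weight \<open>K (\<bar>t\<bar> - ln (fst x)) / fst x\<close>.
  Using \<open>ln (fst x)\<close> instead of \<open>\<bar>x\<bar>\<close> keeps everything smooth at the origin. In the ball the logarithmic
  bound on the derivative of \<open>F\<close> supplies the factor \<open>K (ln (fst x))\<^sup>2\<close> with a constant that is small for
  small \<open>\<eta>\<close>. By Archimedes' hat-box theorem the spherical mean of a function of \<open>fst y\<close> is a
  one-dimensional average, and \<open>K x K y \<le> C K (x + y) (K x + K y)\<close> splits the resulting integrand
  into the weight at \<open>(t, x)\<close> and integrable factors. Hence the map is a contraction.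
\<close>

section \<open>Polynomial decay\<close>

definition decay :: "real \<Rightarrow> real \<Rightarrow> real" where
  "decay a x = (1 + \<bar>x\<bar>) powr (- a)"

text \<open>The odd antiderivative of \<open>decay a\<close>. For \<open>a > 1\<close> it is bounded
  by \<open>1 / (a - 1)\<close>, so the integral of a shifted \<open>decay a\<close> over any
  interval is bounded uniformly in the shift.\<close>

definition decay_primitive :: "real \<Rightarrow> real \<Rightarrow> real" where
  "decay_primitive a x = sgn x * (1 - (1 + \<bar>x\<bar>) powr (1 - a)) / (a - 1)"

lemma decay_pos: "decay a x > 0"
  by (simp add: decay_def add_pos_nonneg)

lemma decay_le_1: "a \<ge> 0 \<Longrightarrow> decay a x \<le> 1"
  using powr_mono[of "- a" 0 "1 + \<bar>x\<bar>"] by (simp add: decay_def split: if_splits)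

lemma decay_minus [simp]: "decay a (- x) = decay a x"
  by (simp add: decay_def)

lemma continuous_on_decay [continuous_intros]:
  "continuous_on S f \<Longrightarrow> continuous_on S (\<lambda>x. decay a (f x))"
  unfolding decay_def by (intro continuous_intros) (auto simp: abs_if)

lemma decay_le:
  assumes "a \<ge> 0" "c > 0" "1 + \<bar>x\<bar> \<le> c * (1 + \<bar>y\<bar>)"
  shows "decay a y \<le> c powr a * decay a x"
proof -
  have "(1 + \<bar>y\<bar>) powr (- a) \<le> ((1 + \<bar>x\<bar>) / c) powr (- a)"
    using assms by (intro powr_mono2') (auto simp: field_simps)
  also have "\<dots> = c powr a * (1 + \<bar>x\<bar>) powr (- a)"
    using assms by (simp add: powr_divide powr_minus field_simps)
  finally show ?thesis by (simp add: decay_def)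
qed

text \<open>The larger of \<bar>x\<bar> and \<bar>y\<bar> is at least half of \<bar>x + y\<bar>, so
  its factor is at most \<open>2 powr a * decay a (x + y)\<close>. The other factor is kept; adding
  both candidates makes the bound symmetric.\<close>

lemma decay_mult_le:
  assumes "a \<ge> 0"
  shows "decay a x * decay a y \<le> 2 powr a * decay a (x + y) * (decay a x + decay a y)"
proof -
  have pos: "decay a x > 0" "decay a y > 0" "decay a (x + y) > 0" "2 powr a > 0"
    by (simp_all add: decay_pos)
  consider "\<bar>y\<bar> \<le> \<bar>x\<bar>" | "\<bar>x\<bar> \<le> \<bar>y\<bar>" by linarith
  then show ?thesis
  proof cases
    case 1
    then have "decay a x \<le> 2 powr a * decay a (x + y)"
      using assms by (intro decay_le) auto
    then have "decay a x * decay a y \<le> (2 powr a * decay a (x + y)) * decay a y"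
      using pos by (intro mult_right_mono) auto
    also have "\<dots> \<le> (2 powr a * decay a (x + y)) * (decay a x + decay a y)"
      using pos by (intro mult_left_mono) auto
    finally show ?thesis .
  next
    case 2
    then have "decay a y \<le> 2 powr a * decay a (x + y)"
      using assms by (intro decay_le) auto
    then have "decay a x * decay a y \<le> decay a x * (2 powr a * decay a (x + y))"
      using pos by (intro mult_left_mono) auto
    also have "\<dots> \<le> (decay a x + decay a y) * (2 powr a * decay a (x + y))"
      using pos by (intro mult_right_mono) auto
    finally show ?thesis by (simp add: mult_ac)
  qed
qed

lemma has_real_derivative_decay_primitive:
  assumes "a > 1"
  shows "(decay_primitive a has_real_derivative decay a x) (at x)"
proof -
  define g where "g = (\<lambda>x. (1 - (1 + x) powr (1 - a)) / (a - 1))"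
  have g: "(g has_real_derivative decay a y) (at y within S)" if "y \<ge> 0" for y S
    unfolding g_def using assms that
    by (auto intro!: derivative_eq_intros simp: decay_def divide_simps) (simp add: algebra_simps)
  have g': "((\<lambda>x. - g (- x)) has_real_derivative decay a y) (at y within S)" if "y \<le> 0" for y S
  proof -
    have "((\<lambda>x. g (- x)) has_real_derivative decay a (- y) * - 1) (at y within S)"
      by (rule DERIV_chain2[where f = g]) (use g[of "- y" UNIV] that in \<open>auto intro!: derivative_eq_intros\<close>)
    from DERIV_minus[OF this] show ?thesis by simp
  qed
  have "decay_primitive a = (\<lambda>x. if x \<in> {0..} then g x else - g (- x))"
    by (auto simp: decay_primitive_def g_def fun_eq_iff sgn_if minus_divide_left)
  \<comment> \<open>The absolute value has a kink at 0, but both branches have the value 0 and the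
    derivative 1 there, so the half lines can be glued.\<close>
  moreover have "((\<lambda>x. if x \<in> {0..} then g x else - g (- x)) has_vector_derivative
     (if x \<in> {0..} then decay a x else decay a x)) (at x within UNIV)"
    by (rule has_vector_derivative_If_within_closures[where T = "{..0}"])
      (use g g' in \<open>auto simp: has_real_derivative_iff_has_vector_derivative g_def\<close>)
  ultimately show ?thesis
    by (simp add: has_real_derivative_iff_has_vector_derivative)
qed

lemma abs_decay_primitive_le:
  assumes "a > 1"
  shows "\<bar>decay_primitive a x\<bar> \<le> 1 / (a - 1)"
proof -
  have "(1 + \<bar>x\<bar>) powr (1 - a) \<le> 1"
    using powr_mono[of "1 - a" 0 "1 + \<bar>x\<bar>"] assms by (simp split: if_splits)
  then show ?thesis
    using assms by (auto simp: decay_primitive_def abs_mult sgn_if divide_right_mono)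
qed

section \<open>Spherical means of functions of the height\<close>

text \<open>The cosine of the angle between the unit vectors with spherical coordinates (\<alpha>,
  \<beta>) and (\<theta>, \<phi>).\<close>

definition zonal :: "real \<Rightarrow> real \<Rightarrow> real \<times> real \<Rightarrow> real" where
  "zonal \<alpha> \<beta> = (\<lambda>(\<theta>, \<phi>). sin \<alpha> * sin \<theta> * cos (\<phi> - \<beta>) + cos \<alpha> * cos \<theta>)"

abbreviation angles :: "(real \<times> real) set" where
  "angles \<equiv> cbox (0, 0) (pi, 2 * pi)"

lemma continuous_on_zonal [continuous_intros]:
  fixes S :: "'z::t2_space set"
  shows "continuous_on S f \<Longrightarrow> continuous_on S g \<Longrightarrow> continuous_on S (\<lambda>x. zonal (f x) \<beta> (g x))"
  unfolding zonal_def case_prod_unfold by (intro continuous_intros)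

lemma abs_zonal_le: "\<bar>zonal \<alpha> \<beta> a\<bar> \<le> 1"
proof -
  obtain \<theta> \<phi> where a: "a = (\<theta>, \<phi>)" by (cases a)
  let ?c = "cos (\<phi> - \<beta>)"
  have c: "\<bar>?c\<bar> \<le> 1" by (rule abs_cos_le_one)
  have "\<bar>zonal \<alpha> \<beta> a\<bar> \<le> \<bar>sin \<alpha> * sin \<theta>\<bar> * \<bar>?c\<bar> + \<bar>cos \<alpha> * cos \<theta>\<bar>"
    unfolding a zonal_def by (auto simp flip: abs_mult intro: abs_triangle_ineq)
  also have "\<dots> \<le> \<bar>sin \<alpha>\<bar> * \<bar>sin \<theta>\<bar> + \<bar>cos \<alpha>\<bar> * \<bar>cos \<theta>\<bar>"
    using c mult_left_le[of "\<bar>?c\<bar>" "\<bar>sin \<alpha> * sin \<theta>\<bar>"] by (simp add: abs_mult)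
  also have "\<dots> \<le> 1"
    using sum_squares_bound[of "\<bar>sin \<alpha>\<bar>" "\<bar>sin \<theta>\<bar>"] sum_squares_bound[of "\<bar>cos \<alpha>\<bar>" "\<bar>cos \<theta>\<bar>"]
      sin_cos_squared_add[of \<alpha>] sin_cos_squared_add[of \<theta>] unfolding power2_abs by linarith
  finally show ?thesis .
qed

text \<open>
  Along a rotation of the pole, the derivative of \<open>h \<circ> zonal\<close> is a divergence in the angular
  coordinates, whose flux through the boundary of the parameter rectangle vanishes.
\<close>

lemma zonal_integral_derivative:
  assumes h: "\<And>s. (h has_real_derivative h' s) (at s)" and h': "continuous_on UNIV h'"
  shows "((\<lambda>\<alpha>. integral angles (\<lambda>a. h (zonal \<alpha> \<beta> a) * sin (fst a))) has_real_derivative 0) (at \<alpha>)"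
proof -
  \<comment> \<open>\<open>q \<alpha>\<close> is the derivative of
    \<open>zonal \<alpha> \<beta>\<close> in \<alpha>.\<close>
  define q where "q = (\<lambda>\<alpha> (\<theta>, \<phi>). cos \<alpha> * sin \<theta> * cos (\<phi> - \<beta>) - sin \<alpha> * cos \<theta>)"
  have hc: "continuous_on UNIV h"
    using h by (meson DERIV_continuous_on has_field_derivative_at_within)
  have ci: "continuous_on S (\<lambda>x. h (f x))" "continuous_on S (\<lambda>x. h' (f x))"
    if "continuous_on S f" for S :: "'z::t2_space set" and f
    using that by (auto intro: continuous_on_compose2[OF hc] continuous_on_compose2[OF h'])
  \<comment> \<open>\<open>f1\<close> is the \<phi>-derivative of
    \<open>cos \<theta> * sin (\<phi> - \<beta>) * h\<close>, which has no net flux by periodicity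
    in \<phi>. \<open>f2\<close> is the \<theta>-derivative of
    \<open>sin \<theta> * cos (\<phi> - \<beta>) * h\<close>, which vanishes at both poles.\<close>
  define f1 where "f1 = (\<lambda>(\<theta>, \<phi>). cos \<theta> * cos (\<phi> - \<beta>) * h (zonal \<alpha> \<beta> (\<theta>, \<phi>))
      - cos \<theta> * sin (\<phi> - \<beta>) * (h' (zonal \<alpha> \<beta> (\<theta>, \<phi>)) * (sin \<alpha> * sin \<theta> * sin (\<phi> - \<beta>))))"
  define f2 where "f2 = (\<lambda>\<theta> \<phi>. cos \<theta> * cos (\<phi> - \<beta>) * h (zonal \<alpha> \<beta> (\<theta>, \<phi>))
      + sin \<theta> * cos (\<phi> - \<beta>) * (h' (zonal \<alpha> \<beta> (\<theta>, \<phi>)) * (sin \<alpha> * cos \<theta> * cos (\<phi> - \<beta>) - cos \<alpha> * sin \<theta>)))"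
  have c1: "continuous_on S f1" for S
    unfolding f1_def case_prod_unfold by (intro continuous_intros ci)
  have c2: "continuous_on S (\<lambda>(\<theta>, \<phi>). f2 \<theta> \<phi>)" for S
    unfolding f2_def case_prod_unfold by (intro continuous_intros ci)
  have "integral {0..2 * pi} (\<lambda>\<phi>. f1 (\<theta>, \<phi>)) = 0" for \<theta>
  proof (rule integral_unique)
    define G where "G = (\<lambda>\<phi>. cos \<theta> * sin (\<phi> - \<beta>) * h (zonal \<alpha> \<beta> (\<theta>, \<phi>)))"
    have "(G has_real_derivative f1 (\<theta>, \<phi>)) (at \<phi> within S)" for \<phi> S
      unfolding G_def f1_def zonal_def case_prod_conv
      by (auto intro!: derivative_eq_intros DERIV_chain2[OF h] simp: algebra_simps)
    then have "((\<lambda>\<phi>. f1 (\<theta>, \<phi>)) has_integral G (2 * pi) - G 0) {0..2 * pi}"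
      by (intro fundamental_theorem_of_calculus)
        (auto simp flip: has_real_derivative_iff_has_vector_derivative)
    moreover have "sin (2 * pi - \<beta>) = sin (0 - \<beta>)" "cos (2 * pi - \<beta>) = cos (0 - \<beta>)"
      by (simp_all add: sin_diff cos_diff)
    then have "G (2 * pi) = G 0"
      unfolding G_def zonal_def case_prod_conv by (simp only:)
    ultimately show "((\<lambda>\<phi>. f1 (\<theta>, \<phi>)) has_integral 0) {0..2 * pi}" by simp
  qed
  then have i1: "integral angles f1 = 0"
    by (simp add: integral_prod_continuous[OF c1])
  have "integral {0..pi} (\<lambda>\<theta>. f2 \<theta> \<phi>) = 0" for \<phi>
  proof (rule integral_unique)
    define G where "G = (\<lambda>\<theta>. sin \<theta> * cos (\<phi> - \<beta>) * h (zonal \<alpha> \<beta> (\<theta>, \<phi>)))"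
    have "(G has_real_derivative f2 \<theta> \<phi>) (at \<theta> within S)" for \<theta> S
      unfolding G_def f2_def zonal_def case_prod_conv
      by (auto intro!: derivative_eq_intros DERIV_chain2[OF h] simp: algebra_simps)
    then have "((\<lambda>\<theta>. f2 \<theta> \<phi>) has_integral G pi - G 0) {0..pi}"
      by (intro fundamental_theorem_of_calculus)
        (auto simp flip: has_real_derivative_iff_has_vector_derivative)
    then show "((\<lambda>\<theta>. f2 \<theta> \<phi>) has_integral 0) {0..pi}" by (simp add: G_def)
  qed
  then have i2: "integral angles (\<lambda>(\<theta>, \<phi>). f2 \<theta> \<phi>) = 0"
    using integral_prod_continuous[OF c2[of angles]] integral_swap_continuous[OF c2[of angles]]
    by simp
  \<comment> \<open>In the difference the terms with \<open>h\<close> cancel, and the terms with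
    \<open>h'\<close> combine through \<open>sin^2 + cos^2 = 1\<close> at the angle \<phi> -
    \<beta>.\<close>
  have eq: "h' (zonal \<alpha> \<beta> a) * q \<alpha> a * sin (fst a) = f1 a - (case a of (\<theta>, \<phi>) \<Rightarrow> f2 \<theta> \<phi>)" for a
  proof -
    obtain \<theta> \<phi> where a: "a = (\<theta>, \<phi>)" by (cases a)
    have s: "sin (\<phi> - \<beta>) * sin (\<phi> - \<beta>) = 1 - cos (\<phi> - \<beta>) * cos (\<phi> - \<beta>)"
      using sin_squared_eq[of "\<phi> - \<beta>"] by (simp add: power2_eq_square)
    show ?thesis
      unfolding a f1_def f2_def q_def case_prod_conv fst_conv using s by algebra
  qed
  have "((\<lambda>\<alpha>. integral angles (\<lambda>a. h (zonal \<alpha> \<beta> a) * sin (fst a))) has_real_derivative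
      integral angles (\<lambda>a. h' (zonal \<alpha> \<beta> a) * q \<alpha> a * sin (fst a))) (at \<alpha> within UNIV)"
  proof (rule leibniz_rule_field_derivative)
    show "((\<lambda>\<alpha>. h (zonal \<alpha> \<beta> a) * sin (fst a)) has_real_derivative
        h' (zonal \<alpha> \<beta> a) * q \<alpha> a * sin (fst a)) (at \<alpha> within UNIV)" for \<alpha> a
      unfolding zonal_def q_def case_prod_unfold
      by (auto intro!: derivative_eq_intros DERIV_chain2[OF h] simp: algebra_simps)
    show "(\<lambda>a. h (zonal \<alpha> \<beta> a) * sin (fst a)) integrable_on angles" for \<alpha>
      by (intro integrable_continuous continuous_intros ci)
    show "continuous_on (UNIV \<times> angles) (\<lambda>(\<alpha>, a). h' (zonal \<alpha> \<beta> a) * q \<alpha> a * sin (fst a))"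
      unfolding q_def case_prod_unfold by (intro continuous_intros ci)
  qed auto
  also have "integral angles (\<lambda>a. h' (zonal \<alpha> \<beta> a) * q \<alpha> a * sin (fst a)) = 0"
    unfolding eq using i1 i2
    by (subst integral_diff) (auto intro!: integrable_continuous c1 c2)
  finally show ?thesis by simp
qed

text \<open>By the vanishing derivative the pole may be moved to \<alpha> = 0. There
  \<open>zonal\<close> is just \<open>cos \<theta>\<close>, and the substitution
  \<open>s = cos \<theta>\<close> uses up the density \<open>sin \<theta>\<close>.\<close>

lemma zonal_integral_smooth:
  assumes h: "\<And>s. (h has_real_derivative h' s) (at s)" and h': "continuous_on UNIV h'"
  shows "integral angles (\<lambda>a. h (zonal \<alpha> \<beta> a) * sin (fst a)) = 2 * pi * integral {-1..1} h"
proof -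
  have hc: "continuous_on S h" for S
    using h by (meson DERIV_continuous_on has_field_derivative_at_within)
  let ?S = "\<lambda>\<alpha>. integral angles (\<lambda>a. h (zonal \<alpha> \<beta> a) * sin (fst a))"
  have "?S \<alpha> = ?S 0"
    using DERIV_isconst_all[of ?S] zonal_integral_derivative[OF h h'] by blast
  also have "\<dots> = integral angles (\<lambda>(\<theta>, \<phi>). h (cos \<theta>) * sin \<theta>)"
    by (simp add: zonal_def case_prod_unfold)
  also have "\<dots> = integral (cbox 0 pi) (\<lambda>\<theta>. integral (cbox 0 (2 * pi)) (\<lambda>\<phi>. h (cos \<theta>) * sin \<theta>))"
    unfolding case_prod_unfold
    by (subst integral_prod_continuous)
      (auto intro!: continuous_intros continuous_on_compose2[OF hc[of UNIV]])
  also have "\<dots> = integral {0..pi} (\<lambda>\<theta>. 2 * pi * (h (cos \<theta>) * sin \<theta>))"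
    by (simp only: integral_const content_cbox box_real) (simp add: mult_ac)
  also have "\<dots> = 2 * pi * integral {0..pi} (\<lambda>\<theta>. h (cos \<theta>) * sin \<theta>)"
    by (rule integral_mult_right)
  also have "integral {0..pi} (\<lambda>\<theta>. h (cos \<theta>) * sin \<theta>) = integral {-1..1} h"
  proof -
    obtain g where g: "\<And>x. x \<in> {-1..1} \<Longrightarrow> (g has_vector_derivative h x) (at x within {-1..1})"
      using antiderivative_continuous[OF hc] by blast
    have "((\<lambda>\<theta>. - g (cos \<theta>)) has_vector_derivative h (cos \<theta>) * sin \<theta>) (at \<theta> within {0..pi})" for \<theta>
    proof -
      have "(g has_real_derivative h (cos \<theta>)) (at (cos \<theta>) within cos ` {0..pi})"
        using g[of "cos \<theta>"]
        by (rule DERIV_subset[OF iffD2[OF has_real_derivative_iff_has_vector_derivative]]) auto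
      then have "((\<lambda>\<theta>. g (cos \<theta>)) has_real_derivative h (cos \<theta>) * - sin \<theta>) (at \<theta> within {0..pi})"
        by (rule DERIV_image_chain[unfolded o_def]) (auto intro!: derivative_eq_intros)
      from DERIV_minus[OF this] show ?thesis
        by (simp add: has_real_derivative_iff_has_vector_derivative)
    qed
    then have "((\<lambda>\<theta>. h (cos \<theta>) * sin \<theta>) has_integral (- g (cos pi)) - (- g (cos 0))) {0..pi}"
      by (intro fundamental_theorem_of_calculus) auto
    moreover have "(h has_integral g 1 - g (-1)) {-1..1}"
      by (intro fundamental_theorem_of_calculus g) auto
    ultimately show ?thesis by (simp add: integral_unique)
  qed
  finally show ?thesis .
qed

text \<open>Both sides are continuous in \<open>h\<close> for the uniform norm on [-1, 1], so the
  differentiable case extends by polynomial approximation.\<close>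

lemma archimedes_hat_box:
  assumes h: "continuous_on {-1..1} h"
  shows "integral angles (\<lambda>a. h (zonal \<alpha> \<beta> a) * sin (fst a)) = 2 * pi * integral {-1..1} h"
proof -
  let ?S = "\<lambda>h. integral angles (\<lambda>a. h (zonal \<alpha> \<beta> a) * sin (fst a))"
  have z: "zonal \<alpha> \<beta> a \<in> {-1..1}" for a
    using abs_zonal_le[of \<alpha> \<beta> a] by (auto simp: abs_le_iff)
  have int: "(\<lambda>a. f (zonal \<alpha> \<beta> a) * sin (fst a)) integrable_on angles"
    if "continuous_on {-1..1} f" for f
    using z by (intro integrable_continuous continuous_intros continuous_on_compose2[OF that]) auto
  have "\<bar>?S h - 2 * pi * integral {-1..1} h\<bar> \<le> 0 + e" if e: "e > 0" for e
  proof -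
    \<comment> \<open>Replacing \<open>h\<close> by \<open>g\<close> moves each side by at most
      \<open>4 * pi * d\<close>, together by \<open>e\<close>.\<close>
    define d where "d = e / (8 * pi)"
    have d: "d > 0" using e by (simp add: d_def)
    obtain g where g: "real_polynomial_function g" "\<And>x. x \<in> {-1..1} \<Longrightarrow> \<bar>h x - g x\<bar> < d"
      using Stone_Weierstrass_real_polynomial_function[OF compact_Icc h d] by blast
    obtain g' where g': "real_polynomial_function g'" "\<And>x. (g has_real_derivative g' x) (at x)"
      using has_real_derivative_polynomial_function[OF g(1)] by blast
    have cg: "continuous_on S g" "continuous_on S g'" for S
      using g(1) g'(1) by (auto simp: real_polynomial_function_eq intro: continuous_on_polymonial_function)
    have eq: "?S g = 2 * pi * integral {-1..1} g"
      by (rule zonal_integral_smooth[OF g'(2) cg(2)])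
    have "norm (?S h - ?S g) \<le> integral angles (\<lambda>a. d * sin (fst a))"
      unfolding integral_diff[OF int[OF h] int[OF cg(1)], symmetric]
    proof (rule integral_norm_bound_integral)
      show "(\<lambda>a. d * sin (fst a)) integrable_on angles"
        using int[of "\<lambda>_. d"] by simp
      fix a assume "a \<in> angles"
      then have "sin (fst a) \<ge> 0"
        by (cases a) (auto simp: cbox_Pair_eq intro: sin_ge_zero)
      then show "norm (h (zonal \<alpha> \<beta> a) * sin (fst a) - g (zonal \<alpha> \<beta> a) * sin (fst a)) \<le> d * sin (fst a)"
        using g(2)[OF z] by (simp add: abs_mult mult_right_mono less_imp_le flip: left_diff_distrib)
    qed (intro integrable_diff int h cg)
    also have "\<dots> = 4 * pi * d"
      using zonal_integral_smooth[of "\<lambda>_. d" "\<lambda>_. 0"] by simp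
    finally have 1: "\<bar>?S h - ?S g\<bar> \<le> 4 * pi * d" by simp
    have "norm (integral {-1..1} h - integral {-1..1} g) \<le> integral {-1..1} (\<lambda>x::real. d)"
      unfolding integral_diff[OF integrable_continuous_interval[OF h] integrable_continuous_interval[OF cg(1)], symmetric]
      by (rule integral_norm_bound_integral)
        (use g(2) in \<open>auto intro!: integrable_continuous_interval continuous_intros h cg simp: less_imp_le\<close>)
    then have "\<bar>2 * pi * integral {-1..1} h - 2 * pi * integral {-1..1} g\<bar> \<le> 4 * pi * d"
      by (simp add: abs_mult flip: right_diff_distrib)
    with 1 eq have "\<bar>?S h - 2 * pi * integral {-1..1} h\<bar> \<le> 8 * pi * d"
      by linarith
    then show ?thesis by (simp add: d_def)
  qed
  then have "\<bar>?S h - 2 * pi * integral {-1..1} h\<bar> \<le> 0"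
    by (rule field_le_epsilon)
  then show ?thesis by simp
qed

section \<open>The height along geodesic spheres\<close>

lemma origin_in_H3: "origin \<in> H3"
  by (simp add: origin_def H3_def mink_def)

lemma cosh_hdist_origin: "x \<in> H3 \<Longrightarrow> cosh (hdist origin x) = fst x"
  using cosh_hdist[OF origin_in_H3] by (simp add: origin_def mink_def)

lemma fst_ge_1: "x \<in> H3 \<Longrightarrow> fst x \<ge> 1"
  using mink_le_minus_1[OF origin_in_H3] by (simp add: origin_def mink_def)

text \<open>The hyperbolic law of cosines: \<alpha> and \<beta> are the spherical angles of
  \<open>x\<close> seen from the origin, and \<open>sqrt ((fst x)^2 - 1)\<close> is the hyperbolic
  sine of its distance from there.\<close>

lemma fst_sphere_param_zonal:
  assumes x: "x \<in> H3"
  obtains \<alpha> \<beta> where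
    "\<And>t a. fst (sphere_param x t a) = cosh t * fst x + sinh t * sqrt ((fst x)\<^sup>2 - 1) * zonal \<alpha> \<beta> a"
proof -
  obtain \<alpha> \<beta> where s: "snd x = sqrt ((fst x)\<^sup>2 - 1) *\<^sub>R snd (direction origin (\<alpha>, \<beta>))"
  proof (cases "fst x = 1")
    case True
    \<comment> \<open>At the origin the square root vanishes, so any angles serve.\<close>
    then show ?thesis using that[of 0 0] H3_fst_sq[OF x] by simp
  next
    case False
    then have X: "fst x > 1" using fst_ge_1[OF x] by simp
    have "hdist origin x > 0"
      using X by (simp add: hdist_eq origin_in_H3 x) (simp add: origin_def mink_def)
    then have "x \<in> sphere_param origin (hdist origin x) ` cbox (0, 0) (pi, 2 * pi)"
      by (subst sphere_param_image[OF origin_in_H3]) (auto simp: x)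
    then obtain a where a: "x = sphere_param origin (hdist origin x) a" by blast
    have "sinh (hdist origin x) = sqrt ((fst x)\<^sup>2 - 1)"
      using X by (simp add: hdist_eq origin_in_H3 x) (simp add: origin_def mink_def sinh_arcosh_real)
    then have "snd x = sqrt ((fst x)\<^sup>2 - 1) *\<^sub>R snd (direction origin a)"
      by (subst a) (simp add: sphere_param_def origin_def)
    then show ?thesis using that by (cases a) auto
  qed
  show ?thesis
  proof (rule that[of \<alpha> \<beta>])
    fix t and a :: "real \<times> real"
    obtain \<theta> \<phi> where a: "a = (\<theta>, \<phi>)" by (cases a)
    let ?w = "direction origin (\<alpha>, \<beta>)"
    have "snd x $ 1 = sqrt ((fst x)\<^sup>2 - 1) * (sin \<alpha> * cos \<beta>)"
      "snd x $ 2 = sqrt ((fst x)\<^sup>2 - 1) * (sin \<alpha> * sin \<beta>)"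
      "snd x $ 3 = sqrt ((fst x)\<^sup>2 - 1) * cos \<alpha>"
      by (subst s, simp add: direction_def frame_def origin_def axis_def)+
    then show "fst (sphere_param x t a)
        = cosh t * fst x + sinh t * sqrt ((fst x)\<^sup>2 - 1) * zonal \<alpha> \<beta> a"
      by (simp add: a sphere_param_def direction_def frame_def zonal_def cos_diff algebra_simps)
  qed
qed

lemma sphere_param_in_H3: "x \<in> H3 \<Longrightarrow> sphere_param x t a \<in> H3"
  unfolding sphere_param_def by (intro geodesic_in_H3 direction_unit)

lemma continuous_on_sphere_param [continuous_intros]:
  fixes S :: "'z::t2_space set"
  assumes "continuous_on S f" "continuous_on S g" "continuous_on S h" "\<And>z. z \<in> S \<Longrightarrow> f z \<in> H3"
  shows "continuous_on S (\<lambda>z. sphere_param (f z) (g z) (h z))"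
proof -
  have "1 + fst (f z) \<noteq> 0" if "z \<in> S" for z
    using fst_ge_1[OF assms(4)[OF that]] by simp
  then show ?thesis
    unfolding sphere_param_def direction_def frame_def case_prod_unfold
    by (intro continuous_intros assms ballI) auto
qed

lemma sin_nonneg_angles: "a \<in> angles \<Longrightarrow> sin (fst a) \<ge> 0"
  by (cases a) (auto simp: cbox_Pair_eq intro: sin_ge_zero)

lemma integral_sin_angles: "integral angles (\<lambda>a. sin (fst a)) = 4 * pi"
  using archimedes_hat_box[of "\<lambda>_. 1" 0 0] by simp

text \<open>The factor \<open>(sinh r)^2\<close> of the area density cancels in the quotient. The
  remaining formula is also right at \<open>r = 0\<close>, which removes the case distinction and
  makes continuity in \<open>r\<close> visible.\<close>

lemma sphere_mean_eq:
  assumes x: "x \<in> H3" and r: "r \<ge> 0"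
  shows "sphere_mean r f x = integral angles (\<lambda>a. f (sphere_param x r a) * sin (fst a)) / (4 * pi)"
proof (cases "r = 0")
  case True
  then show ?thesis
    by (simp add: sphere_mean_def sphere_param_def integral_sin_angles)
next
  case False
  have *: "sphere_integral r g x
      = (sinh r)\<^sup>2 * integral angles (\<lambda>a. g (sphere_param x r a) * sin (fst a))" for g
  proof -
    have "sphere_integral r g x
        = integral angles (\<lambda>a. (sinh r)\<^sup>2 * (g (sphere_param x r a) * sin (fst a)))"
      unfolding sphere_integral_def
    proof (rule integral_cong)
      fix a assume "a \<in> angles"
      then show "g (sphere_param x r a) * area_density (sphere_param x r) a
          = (sinh r)\<^sup>2 * (g (sphere_param x r a) * sin (fst a))"
        using sin_nonneg_angles[of a] by (cases a) (simp add: area_density_sphere x)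
    qed
    then show ?thesis by simp
  qed
  show ?thesis
    using False by (simp add: sphere_mean_def * integral_sin_angles)
qed

text \<open>This follows from
  \<open>exp \<bar>q\<bar> / 2 \<le> cosh q \<le> exp \<bar>q\<bar>\<close>. It is what allows
  \<open>ln (fst x)\<close> to stand in for the distance of \<open>x\<close> from the
  origin.\<close>

lemma abs_ln_cosh_le:
  fixes q :: real
  shows "\<bar>ln (cosh q) - \<bar>q\<bar>\<bar> \<le> ln 2"
proof -
  define E E' where "E = exp \<bar>q\<bar>" and "E' = exp (- \<bar>q\<bar>)"
  have "2 * cosh q = E + E'"
    by (auto simp: cosh_field_def abs_if E_def E'_def)
  moreover have "E' \<le> E" "0 < E'"
    by (simp_all add: E_def E'_def)
  ultimately have *: "E \<le> 2 * cosh q" "cosh q \<le> E"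
    by - linarith+
  have "E > 0" by (simp add: E_def)
  then have "ln (E / 2) \<le> ln (cosh q)" "ln (cosh q) \<le> ln E"
    using * cosh_real_pos[of q] ln_mono[of "E / 2" "cosh q"] ln_mono[of "cosh q" E] by linarith+
  then show ?thesis
    by (auto simp: ln_div E_def)
qed

text \<open>With \<open>X = cosh q\<close> the smallest value, at \<open>s = -1\<close>, is
  \<open>cosh (r - q)\<close> by the addition formula. In logarithmic form this is the triangle
  inequality between the origin, the centre and a point of the sphere.\<close>

lemma zonal_argument_bounds:
  assumes X: "X \<ge> 1" and r: "r \<ge> 0" and s: "s \<in> {-1..1}"
  defines "z \<equiv> cosh r * X + sinh r * sqrt (X\<^sup>2 - 1) * s"
  shows "z \<ge> 1" "\<bar>r - ln X\<bar> \<le> ln z + 2"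
proof -
  define q where "q = arcosh X"
  have q: "q \<ge> 0" "X = cosh q" "sqrt (X\<^sup>2 - 1) = sinh q"
    using X by (simp_all add: q_def sinh_arcosh_real)
  have "sinh r * sinh q * (- 1) \<le> sinh r * sinh q * s"
    using s r q(1) by (intro mult_left_mono) auto
  then have z: "z \<ge> cosh (r - q)"
    using q by (simp add: z_def cosh_diff)
  then show "z \<ge> 1"
    using cosh_real_ge_1 order_trans by blast
  have "ln (cosh (r - q)) \<le> ln z"
    using z cosh_real_pos[of "r - q"] by (intro ln_mono) linarith+
  moreover have "ln X = ln (cosh q)"
    using q(2) by (rule arg_cong)
  \<comment> \<open>Replacing \<open>q\<close> by \<open>ln X\<close> and \<bar>r - q\<bar> by
    \<open>ln (cosh (r - q))\<close> costs \<open>ln 2\<close> each, together less than 2.\<close>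
  ultimately show "\<bar>r - ln X\<bar> \<le> ln z + 2"
    using abs_ln_cosh_le[of "r - q"] abs_ln_cosh_le[of q] q(1) ln_2_less_1 by linarith
qed

text \<open>By the law of cosines the height is an affine function of \<open>zonal\<close>, which
  the hat-box theorem makes uniformly distributed on [-1, 1].\<close>

lemma sphere_mean_zonal:
  assumes x: "x \<in> H3" and r: "r \<ge> 0" and h: "continuous_on {1..} h"
  shows "sphere_mean r (\<lambda>y. h (fst y)) x
    = integral {-1..1} (\<lambda>s. h (cosh r * fst x + sinh r * sqrt ((fst x)\<^sup>2 - 1) * s)) / 2"
proof -
  obtain \<alpha> \<beta> where eq: "\<And>t a. fst (sphere_param x t a)
      = cosh t * fst x + sinh t * sqrt ((fst x)\<^sup>2 - 1) * zonal \<alpha> \<beta> a"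
    using fst_sphere_param_zonal[OF x] by blast
  let ?l = "\<lambda>s. cosh r * fst x + sinh r * sqrt ((fst x)\<^sup>2 - 1) * s"
  have "?l s \<ge> 1" if "s \<in> {-1..1}" for s
    using zonal_argument_bounds(1)[OF fst_ge_1[OF x] r that] .
  then have "continuous_on {-1..1} (\<lambda>s. h (?l s))"
    by (intro continuous_on_compose2[OF h] continuous_intros) auto
  from archimedes_hat_box[OF this, of \<alpha> \<beta>] show ?thesis
    by (simp add: sphere_mean_eq[OF x r] eq)
qed

lemma sphere_param_ln_fst:
  assumes x: "x \<in> H3" and r: "r \<ge> 0"
  shows "\<bar>r - ln (fst x)\<bar> \<le> ln (fst (sphere_param x r a)) + 2"
proof -
  obtain \<alpha> \<beta> where eq: "\<And>t a. fst (sphere_param x t a)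
      = cosh t * fst x + sinh t * sqrt ((fst x)\<^sup>2 - 1) * zonal \<alpha> \<beta> a"
    using fst_sphere_param_zonal[OF x] by blast
  show ?thesis
    unfolding eq using abs_zonal_le[of \<alpha> \<beta> a]
    by (intro zonal_argument_bounds fst_ge_1 x r) auto
qed

section \<open>Comparison, linearity and weighted bounds of spherical means\<close>

lemma integrable_on_sphere:
  assumes "x \<in> H3" "continuous_on H3 f"
  shows "(\<lambda>a. f (sphere_param x r a) * sin (fst a)) integrable_on angles"
  using assms
  by (intro integrable_continuous continuous_intros continuous_on_compose2[OF assms(2)])
    (auto simp: sphere_param_in_H3)

lemma abs_sphere_mean_le:
  assumes x: "x \<in> H3" and r: "r \<ge> 0" and f: "continuous_on H3 f" and g: "continuous_on H3 g"
    and le: "\<And>a. \<bar>f (sphere_param x r a)\<bar> \<le> g (sphere_param x r a)"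
  shows "\<bar>sphere_mean r f x\<bar> \<le> sphere_mean r g x"
proof -
  have "norm (integral angles (\<lambda>a. f (sphere_param x r a) * sin (fst a)))
      \<le> integral angles (\<lambda>a. g (sphere_param x r a) * sin (fst a))"
  proof (intro integral_norm_bound_integral integrable_on_sphere x f g)
    fix a assume "a \<in> angles"
    then show "norm (f (sphere_param x r a) * sin (fst a)) \<le> g (sphere_param x r a) * sin (fst a)"
      using sin_nonneg_angles le[of a] by (simp add: abs_mult mult_right_mono)
  qed
  then show ?thesis
    by (simp add: sphere_mean_eq x r divide_right_mono)
qed




lemma sphere_mean_linear:
  assumes x: "x \<in> H3" and r: "r \<ge> 0" and f: "continuous_on H3 f" and g: "continuous_on H3 g"
  shows "sphere_mean r (\<lambda>y. c * f y + d * g y) x = c * sphere_mean r f x + d * sphere_mean r g x"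
proof -
  have "integral angles (\<lambda>a. (c * f (sphere_param x r a) + d * g (sphere_param x r a)) * sin (fst a))
    = integral angles (\<lambda>a. c * (f (sphere_param x r a) * sin (fst a))
        + d * (g (sphere_param x r a) * sin (fst a)))"
    by (simp add: algebra_simps)
  also have "\<dots> = c * integral angles (\<lambda>a. f (sphere_param x r a) * sin (fst a))
      + d * integral angles (\<lambda>a. g (sphere_param x r a) * sin (fst a))"
    by (simp only: integral_add integrable_on_mult_right integrable_on_sphere x f g integral_mult_right)
  finally show ?thesis
    by (simp add: sphere_mean_eq x r add_divide_distrib)
qed


text \<open>The mean is the average of \<open>h (A + B * s)\<close>, where \<open>h z\<close> is the
  derivative of \<open>decay_primitive a (ln z - c)\<close>. If \<open>B\<close> is comparable to
  \<open>A\<close>, integrating exactly gives a bounded increment divided by \<open>B\<close>.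
  Otherwise, in particular when \<open>B\<close> vanishes, all heights are at least
  \<open>A / 2\<close> and \<open>decay a \<le> 1\<close> suffices. The bound does not depend on
  \<open>c\<close>, and its factor \<open>1 / cosh r\<close> will compensate the \<open>sinh\<close>
  in \<open>wave_I\<close>.\<close>

lemma sphere_mean_decay_le:
  assumes x: "x \<in> H3" and r: "r \<ge> 0" and a: "a > 1"
  shows "sphere_mean r (\<lambda>y. decay a (ln (fst y) - c) / fst y) x
    \<le> (2 + 2 / (a - 1)) / (cosh r * fst x)"
proof -
  define A where "A = cosh r * fst x"
  define B where "B = sinh r * sqrt ((fst x)\<^sup>2 - 1)"
  define h where "h = (\<lambda>z. decay a (ln z - c) / z)"
  have X: "fst x \<ge> 1" by (rule fst_ge_1[OF x])
  have A: "A \<ge> 1"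
    using mult_mono[of 1 "cosh r" 1 "fst x"] X cosh_real_ge_1[of r] by (simp add: A_def)
  have B: "B \<ge> 0"
    using r X by (simp add: B_def)
  have ge1: "A + B * s \<ge> 1" if "s \<in> {-1..1}" for s
    using zonal_argument_bounds(1)[OF X r that] by (simp add: A_def B_def)
  have h: "continuous_on {1..} h"
    unfolding h_def by (intro continuous_intros) auto
  have hl: "continuous_on {-1..1} (\<lambda>s. h (A + B * s))"
    using ge1 by (intro continuous_on_compose2[OF h] continuous_intros) auto
  have nonneg: "h (A + B * s) \<ge> 0" if "s \<in> {-1..1}" for s
    unfolding h_def using ge1[OF that] decay_pos[of a, THEN less_imp_le]
    by (intro divide_nonneg_nonneg) auto
  have "A * (integral {-1..1} (\<lambda>s. h (A + B * s)) / 2) \<le> 2 + 2 / (a - 1)"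
  proof (cases "2 * B \<ge> A")
    case True
    define G where "G = (\<lambda>s. decay_primitive a (ln (A + B * s) - c))"
    have "((\<lambda>s. B * h (A + B * s)) has_integral G 1 - G (-1)) {-1..1}"
    proof (rule fundamental_theorem_of_calculus)
      fix s :: real assume "s \<in> {-1..1}"
      then have "A + B * s > 0" using ge1[of s] by simp
      then have "(G has_real_derivative decay a (ln (A + B * s) - c) * (B / (A + B * s))) (at s)"
        unfolding G_def
        by (intro DERIV_chain2[where f = "decay_primitive a",
              OF has_real_derivative_decay_primitive[OF a]])
          (auto intro!: derivative_eq_intros)
      moreover have "decay a (ln (A + B * s) - c) * (B / (A + B * s)) = B * h (A + B * s)"
        by (simp add: h_def)
      ultimately have "(G has_real_derivative B * h (A + B * s)) (at s)"
        by simp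
      then show "(G has_vector_derivative B * h (A + B * s)) (at s within {-1..1})"
        by (metis has_real_derivative_iff_has_vector_derivative has_field_derivative_at_within)
    qed simp
    then have "B * integral {-1..1} (\<lambda>s. h (A + B * s)) = G 1 - G (-1)"
      by (metis integral_mult_right integral_unique)
    also have "\<dots> \<le> 2 / (a - 1)"
      using abs_decay_primitive_le[OF a, of "ln (A + B * 1) - c"]
        abs_decay_primitive_le[OF a, of "ln (A + B * -1) - c"] by (simp add: G_def abs_le_iff)
    finally have "B * integral {-1..1} (\<lambda>s. h (A + B * s)) \<le> 2 / (a - 1)" .
    moreover have "integral {-1..1} (\<lambda>s. h (A + B * s)) \<ge> 0"
      using nonneg by (intro integral_nonneg integrable_continuous_interval hl)
    then have "A / 2 * integral {-1..1} (\<lambda>s. h (A + B * s)) \<le> B * integral {-1..1} (\<lambda>s. h (A + B * s))"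
      using True by (intro mult_right_mono) auto
    ultimately show ?thesis by simp
  next
    case False
    have "integral {-1..1} (\<lambda>s. h (A + B * s)) \<le> integral {-1..1} (\<lambda>s::real. 2 / A)"
    proof (intro integral_le integrable_continuous_interval hl continuous_intros)
      fix s :: real assume s: "s \<in> {-1..1}"
      then have "B * s \<ge> B * - 1"
        using B by (intro mult_left_mono) auto
      then have z: "A + B * s \<ge> A / 2" using False by simp
      have "h (A + B * s) \<le> 1 / (A / 2)"
        unfolding h_def using z A a by (intro frac_le decay_le_1) auto
      then show "h (A + B * s) \<le> 2 / A" by simp
    qed
    then have "A * (integral {-1..1} (\<lambda>s. h (A + B * s)) / 2) \<le> A * (2 / A)"
      using A by (intro mult_left_mono) auto
    also have "\<dots> \<le> 2 + 2 / (a - 1)"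
      using A a by simp
    finally show ?thesis .
  qed
  moreover have "sphere_mean r (\<lambda>y. h (fst y)) x = integral {-1..1} (\<lambda>s. h (A + B * s)) / 2"
    using sphere_mean_zonal[OF x r h] by (simp add: A_def B_def)
  ultimately have "A * sphere_mean r (\<lambda>y. h (fst y)) x \<le> 2 + 2 / (a - 1)"
    by (simp only:)
  then show ?thesis
    using A unfolding A_def[symmetric] h_def by (simp add: field_simps)
qed




text \<open>
  The pointwise inequality behind the nonlinear estimate: the three decay factors at a point of
  the sphere are traded for the target weight, a factor that is integrable in time, and a factor
  that is integrable in \<open>ln (fst y)\<close>.
\<close>

lemma weight_product_le:
  assumes a: "a \<ge> 0" and m: "\<bar>r - m\<bar> \<le> l + 2" and l: "l \<ge> 0"
  shows "decay a l ^ 2 * decay a (T - r - l)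
    \<le> 12 powr a * decay a (T - m) * (decay a (T - r) + decay a (r - m))
      * (decay a (l - (T - r)) + decay a (l - 0))"
proof -
  let ?d = "decay a"
  note nn = decay_pos[of a, THEN less_imp_le]
  \<comment> \<open>The arguments \<open>l\<close> and \<open>T - r - l\<close> add up to
    \<open>T - r\<close>. The two summands are shifts \<open>l - c\<close> with
    \<open>c = T - r\<close> and \<open>c = 0\<close>, the form whose spherical mean is under
    control.\<close>
  have 1: "?d l * ?d (T - r - l) \<le> 2 powr a * ?d (T - r) * (?d (l - (T - r)) + ?d (l - 0))"
    using decay_mult_le[OF a, of l "T - r - l"] decay_minus[of a "l - (T - r)"] by (simp add: add_ac)
  \<comment> \<open>The second copy of \<open>?d l\<close> pays for the distance to the centre:
    \<open>1 + \<bar>r - m\<bar> \<le> 3 + l \<le> 3 * (1 + l)\<close>.\<close>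
  have 2: "?d l \<le> 3 powr a * ?d (r - m)"
    using a m l by (intro decay_le) auto
  \<comment> \<open>Here the arguments add up to \<open>T - m\<close>, which produces the target
    weight.\<close>
  have 3: "?d (T - r) * ?d (r - m) \<le> 2 powr a * ?d (T - m) * (?d (T - r) + ?d (r - m))"
    using decay_mult_le[OF a, of "T - r" "r - m"] by simp
  let ?E = "?d (l - (T - r)) + ?d (l - 0)"
  have E: "?E \<ge> 0" by (intro add_nonneg_nonneg nn)
  have "?d l ^ 2 * ?d (T - r - l) = ?d l * (?d l * ?d (T - r - l))"
    by (simp add: power2_eq_square)
  also have "\<dots> \<le> (3 powr a * ?d (r - m)) * (2 powr a * ?d (T - r) * ?E)"
    by (intro mult_mono 1 2 mult_nonneg_nonneg nn) auto
  also have "\<dots> = 3 powr a * 2 powr a * ?E * (?d (T - r) * ?d (r - m))"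
    by (simp only: mult_ac)
  also have "\<dots> \<le> 3 powr a * 2 powr a * ?E * (2 powr a * ?d (T - m) * (?d (T - r) + ?d (r - m)))"
    by (intro mult_left_mono 3 mult_nonneg_nonneg E) auto
  also have "\<dots> = (3 powr a * 2 powr a * 2 powr a) * ?d (T - m) * (?d (T - r) + ?d (r - m)) * ?E"
    by (simp only: mult_ac)
  also have "3 powr a * 2 powr a * 2 powr a = (12::real) powr a"
    by (simp flip: powr_mult)
  finally show ?thesis .
qed

text \<open>\<open>T\<close> stands for the absolute time at which the result is wanted and
  \<open>T - r\<close> for the one at which \<open>f\<close> is taken. On the sphere
  \<open>weight_product_le\<close> applies with \<open>l = ln (fst y)\<close> and
  \<open>m = ln (fst x)\<close>; everything independent of \<open>y\<close> is collected in
  \<open>Q\<close>, and two means of shifted decay remain.\<close>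

lemma sphere_mean_weight_le:
  assumes x: "x \<in> H3" and r: "r \<ge> 0" and a: "a > 1" and f: "continuous_on H3 f" and M: "M \<ge> 0"
    and le: "\<And>y. y \<in> H3 \<Longrightarrow>
      \<bar>f y\<bar> \<le> M * (decay a (ln (fst y)) ^ 2 * (decay a (T - r - ln (fst y)) / fst y))"
  shows "cosh r * \<bar>sphere_mean r f x\<bar>
    \<le> M * (12 powr a * (4 + 4 / (a - 1))) * (decay a (T - r) + decay a (r - ln (fst x)))
      * (decay a (T - ln (fst x)) / fst x)"
proof -
  define Q where "Q = M * (12 powr a * decay a (T - ln (fst x))
      * (decay a (T - r) + decay a (r - ln (fst x))))"
  have Q: "Q \<ge> 0"
    unfolding Q_def by (intro mult_nonneg_nonneg M add_nonneg_nonneg decay_pos[THEN less_imp_le]) auto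
  let ?g = "\<lambda>c y. decay a (ln (fst y) - c) / fst y"
  have gc: "continuous_on H3 (?g c)" for c
    by (intro continuous_intros ballI) (use fst_ge_1 in fastforce)+
  have "\<bar>sphere_mean r f x\<bar> \<le> sphere_mean r (\<lambda>y. Q * ?g (T - r) y + Q * ?g 0 y) x"
  proof (intro abs_sphere_mean_le x r f continuous_on_add continuous_on_mult_left gc)
    fix b
    let ?y = "sphere_param x r b"
    have y: "?y \<in> H3" "fst ?y \<ge> 1"
      using sphere_param_in_H3[OF x] fst_ge_1 by auto
    have w: "decay a (ln (fst ?y)) ^ 2 * decay a (T - r - ln (fst ?y))
        \<le> 12 powr a * decay a (T - ln (fst x)) * (decay a (T - r) + decay a (r - ln (fst x)))
          * (decay a (ln (fst ?y) - (T - r)) + decay a (ln (fst ?y) - 0))"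
      using sphere_param_ln_fst[OF x r] a y(2) by (intro weight_product_le) auto
    have "\<bar>f ?y\<bar> \<le> M * (decay a (ln (fst ?y)) ^ 2 * (decay a (T - r - ln (fst ?y)) / fst ?y))"
      by (rule le[OF y(1)])
    also have "\<dots> = M * (decay a (ln (fst ?y)) ^ 2 * decay a (T - r - ln (fst ?y))) / fst ?y"
      by simp
    also have "\<dots> \<le> M * (12 powr a * decay a (T - ln (fst x)) * (decay a (T - r) + decay a (r - ln (fst x)))
          * (decay a (ln (fst ?y) - (T - r)) + decay a (ln (fst ?y) - 0))) / fst ?y"
      using y(2) by (intro divide_right_mono mult_left_mono w M) auto
    also have "\<dots> = Q * ?g (T - r) ?y + Q * ?g 0 ?y"
      by (simp add: Q_def algebra_simps add_divide_distrib)
    finally show "\<bar>f ?y\<bar> \<le> Q * ?g (T - r) ?y + Q * ?g 0 ?y" .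
  qed
  also have "\<dots> = Q * sphere_mean r (?g (T - r)) x + Q * sphere_mean r (?g 0) x"
    by (rule sphere_mean_linear[OF x r gc gc])
  also have "\<dots> \<le> Q * ((2 + 2 / (a - 1)) / (cosh r * fst x)) + Q * ((2 + 2 / (a - 1)) / (cosh r * fst x))"
    by (intro add_mono mult_left_mono sphere_mean_decay_le x r a Q)
  also have "\<dots> = (Q * (4 + 4 / (a - 1)) / fst x) / cosh r"
    by (simp add: distrib_left mult_ac flip: mult_2)
  finally have "cosh r * \<bar>sphere_mean r f x\<bar> \<le> Q * (4 + 4 / (a - 1)) / fst x"
    by (subst (asm) pos_le_divide_eq) (simp_all add: mult.commute)
  also have "\<dots> = M * (12 powr a * (4 + 4 / (a - 1))) * (decay a (T - r) + decay a (r - ln (fst x)))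
      * (decay a (T - ln (fst x)) / fst x)"
    by (simp add: Q_def)
  finally show ?thesis .
qed

section \<open>The Duhamel term\<close>

text \<open>The parameter \<open>z\<close> moves radius, centre and integrand at once, as happens in
  the Duhamel integrand.\<close>

lemma continuous_on_sphere_mean:
  fixes S :: "'z::t2_space set"
  assumes r: "continuous_on S r" and x: "continuous_on S x"
    and H3: "\<And>z. z \<in> S \<Longrightarrow> x z \<in> H3" and r0: "\<And>z. z \<in> S \<Longrightarrow> r z \<ge> 0"
    and g: "continuous_on (S \<times> H3) (\<lambda>(z, y). g z y)"
  shows "continuous_on S (\<lambda>z. sphere_mean (r z) (g z) (x z))"
proof -
  have c: "continuous_on (S \<times> angles) (\<lambda>(z, a). g z (sphere_param (x z) (r z) a) * sin (fst a))"
    unfolding case_prod_unfold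
  proof (intro continuous_intros continuous_on_compose2[OF g[unfolded case_prod_unfold],
        where f = "\<lambda>w. (fst w, sphere_param (x (fst w)) (r (fst w)) (snd w))", simplified fst_conv snd_conv])
  qed (auto intro!: continuous_intros continuous_on_compose2[OF x] continuous_on_compose2[OF r]
        H3 sphere_param_in_H3)
  have "continuous_on S (\<lambda>z. integral angles (\<lambda>a. g z (sphere_param (x z) (r z) a) * sin (fst a)) / (4 * pi))"
    by (intro continuous_intros integral_continuous_on_param c) auto
  then show ?thesis
    by (rule continuous_on_eq) (simp add: sphere_mean_eq H3 r0)
qed

lemma continuous_on_wave_I:
  fixes S :: "'z::t2_space set"
  assumes "continuous_on S r" "continuous_on S x" "\<And>z. z \<in> S \<Longrightarrow> x z \<in> H3"
    and "continuous_on (S \<times> H3) (\<lambda>(z, y). g z y)"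
  shows "continuous_on S (\<lambda>z. wave_I (r z) (x z) (g z))"
  unfolding wave_I_def using assms
  by (intro continuous_intros continuous_on_sphere_mean) auto

text \<open>
  The substitution \<open>\<tau> = s t\<close> treats both signs of \<open>t\<close> at once and makes the joint continuity evident.
\<close>

definition duhamel :: "(real \<Rightarrow> real) \<Rightarrow> (real \<times> pt \<Rightarrow> real) \<Rightarrow> real \<times> pt \<Rightarrow> real" where
  "duhamel F v = (\<lambda>(t, x). integral {0..1} (\<lambda>s. t * wave_I (s * t) x (\<lambda>y. F (v (t - s * t, y)))))"

lemma continuous_on_nonlinearity:
  fixes S :: "'z::topological_space set"
  assumes F: "continuous_on UNIV F" and v: "continuous_on (UNIV \<times> H3) v"
    and f: "continuous_on S f"
  shows "continuous_on (S \<times> H3) (\<lambda>(z, y). F (v (f z, y)))"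
  unfolding case_prod_unfold
  by (intro continuous_on_compose2[OF F] continuous_on_compose2[OF v] continuous_intros
      continuous_on_compose2[OF f]) auto

lemma continuous_on_duhamel:
  assumes F: "continuous_on UNIV F" and v: "continuous_on (UNIV \<times> H3) v"
  shows "continuous_on (UNIV \<times> H3) (duhamel F v)"
proof -
  let ?f = "\<lambda>z s. fst z * wave_I (s * fst z) (snd z) (\<lambda>y. F (v (fst z - s * fst z, y)))"
  have "continuous_on ((UNIV \<times> H3) \<times> cbox 0 1) (\<lambda>w. ?f (fst w) (snd w))"
    by (intro continuous_intros continuous_on_wave_I continuous_on_nonlinearity[OF F v]) auto
  then have "continuous_on (UNIV \<times> H3) (\<lambda>z. integral (cbox 0 1) (?f z))"
    by (intro integral_continuous_on_param) (simp add: case_prod_unfold)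
  then show ?thesis
    by (simp add: duhamel_def case_prod_unfold)
qed

lemma duhamel_eq_LBINT:
  assumes F: "continuous_on UNIV F" and v: "continuous_on (UNIV \<times> H3) v" and x: "x \<in> H3"
  shows "(LBINT \<tau>=0..t. wave_I \<tau> x (\<lambda>y. F (v (t - \<tau>, y)))) = duhamel F v (t, x)"
proof -
  let ?f = "\<lambda>\<tau>. wave_I \<tau> x (\<lambda>y. F (v (t - \<tau>, y)))"
  have f: "continuous_on S ?f" for S
    by (intro continuous_intros continuous_on_wave_I continuous_on_nonlinearity[OF F v] x)
  have "(LBINT s=ereal 0..ereal 1. t *\<^sub>R ?f (s * t)) = (LBINT \<tau>=ereal (0 * t)..ereal (1 * t). ?f \<tau>)"
    by (rule interval_integral_substitution_finite)
      (auto intro!: derivative_eq_intros f)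
  moreover have "continuous_on {0..1} (\<lambda>s. t * ?f (s * t))"
    by (intro continuous_intros continuous_on_compose2[OF f[of UNIV]]) auto
  then have "(LBINT s=ereal 0..ereal 1. t * ?f (s * t)) = integral {0..1} (\<lambda>s. t * ?f (s * t))"
    by (intro interval_integral_eq_integral borel_integrable_atLeastAtMost') auto
  ultimately show ?thesis
    by (simp add: duhamel_def zero_ereal_def)
qed

lemma duhamel_zero: "F 0 = 0 \<Longrightarrow> x \<in> H3 \<Longrightarrow> duhamel F (\<lambda>_. 0) (t, x) = 0"
  by (simp add: duhamel_def wave_I_def sphere_mean_eq)

lemma abs_sinh_le_cosh: "\<bar>sinh x\<bar> \<le> cosh x" for x :: real
  using sinh_less_cosh_real[of x] sinh_less_cosh_real[of "- x"] by (simp add: abs_le_iff)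

text \<open>The growth of \<open>sinh\<close> is absorbed by the gain of \<open>cosh\<close> in the
  weighted mean estimate. What is left of the time integral is a sum of two shifted decays, whose
  integral is bounded uniformly in \<open>t\<close> and \<open>x\<close>.\<close>

lemma duhamel_diff_le:
  assumes F: "continuous_on UNIV F" and u: "continuous_on (UNIV \<times> H3) u"
    and v: "continuous_on (UNIV \<times> H3) v" and x: "x \<in> H3" and a: "a > 1" and M: "M \<ge> 0"
    and le: "\<And>t y. y \<in> H3 \<Longrightarrow> \<bar>F (u (t, y)) - F (v (t, y))\<bar>
      \<le> M * (decay a (ln (fst y)) ^ 2 * (decay a (\<bar>t\<bar> - ln (fst y)) / fst y))"
  shows "\<bar>duhamel F u (t, x) - duhamel F v (t, x)\<bar>
    \<le> M * (12 powr a * (4 + 4 / (a - 1)) * (4 / (a - 1))) * (decay a (\<bar>t\<bar> - ln (fst x)) / fst x)"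
proof -
  define T where "T = \<bar>t\<bar>"
  define l where "l = ln (fst x)"
  define W where "W = M * (12 powr a * (4 + 4 / (a - 1))) * (decay a (T - l) / fst x)"
  define I where "I = (\<lambda>v s. t * wave_I (s * t) x (\<lambda>y. F (v (t - s * t, y))))"
  \<comment> \<open>The time kernel after the substitution with \<open>r = s * T\<close>; the factor
    \<open>T\<close> is the Jacobian, so \<open>decay_primitive\<close> integrates it
    exactly.\<close>
  define k where "k = (\<lambda>s. T * decay a (T - s * T) + T * decay a (s * T - l))"
  have X: "fst x > 0" using fst_ge_1[OF x] by simp
  have W: "W \<ge> 0"
    unfolding W_def using a M X decay_pos[of a, THEN less_imp_le]
    by (intro mult_nonneg_nonneg divide_nonneg_nonneg add_nonneg_nonneg) auto
  have slice: "continuous_on H3 (\<lambda>y. F (w (q, y)))" if "continuous_on (UNIV \<times> H3) w" for w and q :: real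
    by (intro continuous_on_compose2[OF F] continuous_on_compose2[OF that] continuous_intros) auto
  have int: "I w integrable_on {0..1}" if "continuous_on (UNIV \<times> H3) w" for w
    unfolding I_def
    by (intro integrable_continuous_interval continuous_intros continuous_on_wave_I
        continuous_on_nonlinearity[OF F that] x)
  have k: "(k has_integral (decay_primitive a T - decay_primitive a (T - T))
      + (decay_primitive a (T - l) - decay_primitive a (- l))) {0..1}"
  proof -
    define G where "G = (\<lambda>s. - decay_primitive a (T - s * T) + decay_primitive a (s * T - l))"
    have "(G has_real_derivative k s) (at s within {0..1})" for s
      unfolding G_def k_def
      by (rule derivative_eq_intros
          DERIV_chain2[where f = "decay_primitive a", OF has_real_derivative_decay_primitive[OF a]] refl
          | simp)+
    then have "(k has_integral G 1 - G 0) {0..1}"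
      by (intro fundamental_theorem_of_calculus)
        (auto simp flip: has_real_derivative_iff_has_vector_derivative)
    then show ?thesis by (simp add: G_def algebra_simps)
  qed
  have pointwise: "\<bar>I u s - I v s\<bar> \<le> W * k s" if s: "s \<in> {0..1}" for s
  proof -
    define f where "f = (\<lambda>y. F (u (t - s * t, y)) - F (v (t - s * t, y)))"
    have f: "continuous_on H3 f"
      unfolding f_def by (intro continuous_intros slice u v)
    \<comment> \<open>For \<open>s\<close> in [0, 1] the radius and the absolute time of the slice
      add up to \<open>T\<close>, for either sign of \<open>t\<close>.\<close>
    have sT: "\<bar>s * t\<bar> = s * T" "\<bar>t - s * t\<bar> = T - s * T" "s * T \<ge> 0"
      using s abs_mult[of "1 - s" t] by (auto simp: T_def abs_mult algebra_simps)
    have "sphere_mean (s * T) f x = sphere_mean (s * T) (\<lambda>y. F (u (t - s * t, y))) x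
        - sphere_mean (s * T) (\<lambda>y. F (v (t - s * t, y))) x"
      using sphere_mean_linear[OF x sT(3) slice[OF u, of "t - s * t"] slice[OF v, of "t - s * t"], of 1 "-1"]
      by (simp add: f_def)
    then have "I u s - I v s = t * (sinh (s * t) * sphere_mean (s * T) f x)"
      by (simp add: I_def wave_I_def sT right_diff_distrib)
    then have "\<bar>I u s - I v s\<bar> = T * (\<bar>sinh (s * t)\<bar> * \<bar>sphere_mean (s * T) f x\<bar>)"
      by (simp add: abs_mult T_def)
    also have "\<dots> \<le> T * (cosh (s * T) * \<bar>sphere_mean (s * T) f x\<bar>)"
    proof (intro mult_left_mono mult_right_mono)
      show "\<bar>sinh (s * t)\<bar> \<le> cosh (s * T)"
        using abs_sinh_le_cosh[of "s * t"] cosh_real_abs[of "s * t"] by (simp only: sT)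
    qed (auto simp: T_def)
    also have "\<dots> \<le> T * (M * (12 powr a * (4 + 4 / (a - 1))) * (decay a (T - s * T) + decay a (s * T - ln (fst x)))
      * (decay a (T - ln (fst x)) / fst x))"
    proof (intro mult_left_mono sphere_mean_weight_le x sT a f M)
      show "\<bar>f y\<bar> \<le> M * (decay a (ln (fst y)) ^ 2 * (decay a (T - s * T - ln (fst y)) / fst y))"
        if "y \<in> H3" for y
        using le[OF that, of "t - s * t"] by (simp add: f_def sT)
    qed (auto simp: T_def)
    also have "\<dots> = W * k s"
      unfolding W_def k_def l_def by (simp only: mult_ac flip: distrib_left)
    finally show ?thesis .
  qed
  have "duhamel F u (t, x) - duhamel F v (t, x) = integral {0..1} (\<lambda>s. I u s - I v s)"
    using integral_diff[OF int[OF u] int[OF v]] by (simp add: duhamel_def I_def)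
  also have "\<bar>\<dots>\<bar> \<le> integral {0..1} (\<lambda>s. W * k s)"
    unfolding real_norm_def[symmetric]
    by (intro integral_norm_bound_integral integrable_diff int u v integrable_on_mult_right
        has_integral_integrable[OF k]) (simp add: pointwise)
  also have "\<dots> = W * ((decay_primitive a T - decay_primitive a (T - T))
      + (decay_primitive a (T - l) - decay_primitive a (- l)))"
    by (simp only: integral_mult_right integral_unique[OF k])
  \<comment> \<open>Four values of the primitive, each at most \<open>1 / (a - 1)\<close> in
    absolute value.\<close>
  also have "\<dots> \<le> W * (4 / (a - 1))"
    using abs_decay_primitive_le[OF a, of T] abs_decay_primitive_le[OF a, of "T - T"]
      abs_decay_primitive_le[OF a, of "T - l"] abs_decay_primitive_le[OF a, of "- l"]
    by (intro mult_left_mono W) (simp add: abs_le_iff)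
  finally show ?thesis
    unfolding W_def T_def l_def by (simp only: mult_ac)
qed

section \<open>The linear solution\<close>

text \<open>The derivative in \<open>r\<close> of the geodesic
  \<open>sphere_param x r a\<close>.\<close>

definition velocity :: "pt \<Rightarrow> real \<Rightarrow> real \<times> real \<Rightarrow> pt" where
  "velocity x r a = sinh r *\<^sub>R x + cosh r *\<^sub>R direction x a"

text \<open>If \<open>G\<close> is the gradient field of \<open>f\<close>, this is the radial
  derivative of the spherical mean of \<open>f\<close>, in a form that is visibly continuous in
  \<open>x\<close> and \<open>r\<close> together.\<close>

definition mean_derivative :: "(pt \<Rightarrow> pt) \<Rightarrow> pt \<Rightarrow> real \<Rightarrow> real" where
  "mean_derivative G x r =
     integral angles (\<lambda>a. mink (G (sphere_param x r a)) (velocity x r a) * sin (fst a)) / (4 * pi)"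

lemma continuous_on_velocity [continuous_intros]:
  fixes S :: "'z::t2_space set"
  assumes "continuous_on S f" "continuous_on S g" "continuous_on S h" "\<And>z. z \<in> S \<Longrightarrow> f z \<in> H3"
  shows "continuous_on S (\<lambda>z. velocity (f z) (g z) (h z))"
proof -
  have "1 + fst (f z) \<noteq> 0" if "z \<in> S" for z
    using fst_ge_1[OF assms(4)[OF that]] by simp
  then show ?thesis
    unfolding velocity_def direction_def frame_def case_prod_unfold
    by (intro continuous_intros assms ballI) auto
qed

lemma velocity_unit_tangent:
  assumes "x \<in> H3"
  shows "velocity x r a \<in> tangent_space (sphere_param x r a)" "riem_norm (velocity x r a) = 1"
proof -
  have *: "mink x x = -1" "mink x (direction x a) = 0" "mink (direction x a) x = 0"
    "mink (direction x a) (direction x a) = 1"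
    using assms direction_unit[OF assms, of a] by (auto simp: H3_def tangent_space_def mink_commute)
  show "velocity x r a \<in> tangent_space (sphere_param x r a)"
    by (simp add: tangent_space_def velocity_def sphere_param_def mink_simps *)
  show "riem_norm (velocity x r a) = 1"
    using hyperbolic_pythagoras[of r]
    by (simp add: riem_norm_def velocity_def mink_simps * power2_eq_square)
qed

lemma continuous_on_gradient_flux:
  fixes S :: "'z::t2_space set"
  assumes "continuous_on S r" "continuous_on S x" "\<And>z. z \<in> S \<Longrightarrow> x z \<in> H3"
    and "continuous_on H3 G"
  shows "continuous_on (S \<times> angles)
    (\<lambda>(z, a). mink (G (sphere_param (x z) (r z) a)) (velocity (x z) (r z) a) * sin (fst a))"
  unfolding case_prod_unfold using assms(1-3)
  by (intro continuous_intros continuous_on_compose2[OF assms(4)])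
    (auto intro!: continuous_intros sphere_param_in_H3 intro: continuous_on_compose2[OF assms(1)]
      continuous_on_compose2[OF assms(2)])

lemma continuous_on_mean_derivative:
  fixes S :: "'z::t2_space set"
  assumes "continuous_on S r" "continuous_on S x" "\<And>z. z \<in> S \<Longrightarrow> x z \<in> H3"
    and "continuous_on H3 G"
  shows "continuous_on S (\<lambda>z. mean_derivative G (x z) (r z))"
  unfolding mean_derivative_def
  by (intro continuous_intros integral_continuous_on_param continuous_on_gradient_flux assms) auto

lemma has_derivative_along_geodesic:
  assumes x: "x \<in> H3" and f: "\<And>y. y \<in> H3 \<Longrightarrow> has_gradient f (G y) y"
  shows "((\<lambda>r. f (sphere_param x r a)) has_real_derivative
    mink (G (sphere_param x r a)) (velocity x r a)) (at r)"
proof -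
  have "((\<lambda>r. sphere_param x r a) has_derivative (\<lambda>h. h *\<^sub>R velocity x r a)) (at r)"
    unfolding sphere_param_def velocity_def
    by (auto intro!: derivative_eq_intros simp: algebra_simps)
  \<comment> \<open>A gradient only differentiates within \<open>H3\<close>; this is enough for the
    chain rule because the whole geodesic stays in \<open>H3\<close>.\<close>
  moreover have "(f has_derivative mink (G (sphere_param x r a)))
      (at (sphere_param x r a) within range (\<lambda>r. sphere_param x r a))"
  proof (rule has_derivative_subset)
    show "(f has_derivative mink (G (sphere_param x r a))) (at (sphere_param x r a) within H3)"
      using f[OF sphere_param_in_H3[OF x, of r a]] by (simp add: has_gradient_def)
    show "range (\<lambda>r. sphere_param x r a) \<subseteq> H3"
      using sphere_param_in_H3[OF x] by blast
  qed
  ultimately have "((\<lambda>r. f (sphere_param x r a)) has_derivative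
      (\<lambda>h. mink (G (sphere_param x r a)) (h *\<^sub>R velocity x r a))) (at r)"
    by (rule has_derivative_in_compose)
  then show ?thesis
    by (simp add: has_field_derivative_def mink_simps mult_commute_abs)
qed

text \<open>The product rule, with \<open>sgn t * sinh t = sinh \<bar>t\<bar>\<close> from the chain
  rule through the absolute value.\<close>

lemma deriv_wave_I:
  assumes x: "x \<in> H3" and f: "\<And>y. y \<in> H3 \<Longrightarrow> has_gradient f (G y) y" and G: "continuous_on H3 G"
  shows "deriv (\<lambda>s. wave_I s x f) t
    = cosh t * sphere_mean \<bar>t\<bar> f x + sinh \<bar>t\<bar> * mean_derivative G x \<bar>t\<bar>"
proof -
  \<comment> \<open>\<open>N\<close> extends the mean to negative radii by the same integral, so
    that it has a two-sided derivative even at 0.\<close>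
  define N where "N = (\<lambda>r. integral angles (\<lambda>a. f (sphere_param x r a) * sin (fst a)) / (4 * pi))"
  have fc: "continuous_on H3 f"
    unfolding continuous_on_eq_continuous_within using f
    by (auto simp: has_gradient_def intro: has_derivative_continuous)
  have mean: "sphere_mean r f x = N r" if "r \<ge> 0" for r
    using that by (simp add: sphere_mean_eq[OF x] N_def)
  have N: "(N has_real_derivative mean_derivative G x r) (at r)" for r
    unfolding N_def mean_derivative_def
  proof (rule DERIV_cdivide)
    show "((\<lambda>r. integral angles (\<lambda>a. f (sphere_param x r a) * sin (fst a))) has_real_derivative
      integral angles (\<lambda>a. mink (G (sphere_param x r a)) (velocity x r a) * sin (fst a))) (at r)"
    proof (rule leibniz_rule_field_derivative)
      show "((\<lambda>r. f (sphere_param x r a) * sin (fst a)) has_real_derivative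
        mink (G (sphere_param x r a)) (velocity x r a) * sin (fst a)) (at r within UNIV)" for r a
        by (intro DERIV_cmult_right has_derivative_along_geodesic x f)
      show "(\<lambda>a. f (sphere_param x r a) * sin (fst a)) integrable_on angles" for r
        by (rule integrable_on_sphere[OF x fc])
      show "continuous_on (UNIV \<times> angles)
          (\<lambda>(r, a). mink (G (sphere_param x r a)) (velocity x r a) * sin (fst a))"
        by (rule continuous_on_gradient_flux) (auto simp: x G intro: continuous_intros)
    qed auto
  qed
  have "((\<lambda>s. sinh s * N \<bar>s\<bar>) has_real_derivative
      cosh t * N \<bar>t\<bar> + sinh \<bar>t\<bar> * mean_derivative G x \<bar>t\<bar>) (at t)"
  proof (cases "t = 0")
    case False
    have "(abs has_real_derivative sgn t) (at t)"
    proof (cases "t > 0")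
      case True
      then show ?thesis
        using has_field_derivative_transform_within_open[OF DERIV_ident, of "{0<..}" t abs] by simp
    next
      case neg: False
      have "(uminus has_real_derivative - 1) (at t)"
        by (auto intro!: derivative_eq_intros)
      then show ?thesis
        using has_field_derivative_transform_within_open[of uminus "- 1" t "{..<0}" abs] neg False
        by simp
    qed
    then have "((\<lambda>s. sinh s * N \<bar>s\<bar>) has_real_derivative
      cosh t * N \<bar>t\<bar> + mean_derivative G x \<bar>t\<bar> * sgn t * sinh t) (at t)"
      by (intro DERIV_mult DERIV_chain2[where f = N, OF N] has_field_derivative_sinh[OF DERIV_ident, simplified])
    moreover have "mean_derivative G x \<bar>t\<bar> * sgn t * sinh t = sinh \<bar>t\<bar> * mean_derivative G x \<bar>t\<bar>"
      by (auto simp: sgn_if)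
    ultimately show ?thesis
      by simp
  next
    case True
    \<comment> \<open>At 0 the chain rule through the absolute value fails, but \<open>sinh\<close>
      vanishes there, and the difference quotient is \<open>sinh s / s\<close> times a continuous
      function.\<close>
    have "isCont (\<lambda>s. N \<bar>s\<bar>) 0"
      by (intro continuous_intros isCont_o2[OF _ DERIV_isCont[OF N]])
    then have "((\<lambda>s. N \<bar>s\<bar>) \<longlongrightarrow> N 0) (at 0)"
      by (simp add: isCont_def)
    moreover have "((\<lambda>s. sinh s / s) \<longlongrightarrow> 1) (at (0::real))"
      using has_field_derivative_sinh[OF DERIV_ident, of "0::real" UNIV] by (simp add: DERIV_def)
    ultimately have "((\<lambda>s. sinh s / s * N \<bar>s\<bar>) \<longlongrightarrow> 1 * N 0) (at 0)"
      by (intro tendsto_mult)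
    then show ?thesis
      by (simp add: True DERIV_def)
  qed
  moreover have "(\<lambda>s. wave_I s x f) = (\<lambda>s. sinh s * N \<bar>s\<bar>)"
    by (simp add: wave_I_def mean)
  ultimately show ?thesis
    using mean[of "\<bar>t\<bar>"] by (simp add: DERIV_imp_deriv)
qed

text \<open>The velocity is a unit tangent vector, so the Cauchy-Schwarz inequality in the tangent
  space bounds the flux by the norm of the gradient.\<close>

lemma abs_mean_derivative_le:
  assumes x: "x \<in> H3" and r: "r \<ge> 0" and f: "\<And>y. y \<in> H3 \<Longrightarrow> has_gradient f (G y) y"
    and G: "continuous_on H3 G" and g: "continuous_on H3 g"
    and le: "\<And>y. y \<in> H3 \<Longrightarrow> riem_norm (G y) \<le> g y"
  shows "\<bar>mean_derivative G x r\<bar> \<le> sphere_mean r g x"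
proof -
  have c: "continuous_on angles (\<lambda>a. mink (G (sphere_param x r a)) (velocity x r a) * sin (fst a))"
    by (intro continuous_intros continuous_on_compose2[OF G])
      (auto intro!: continuous_intros simp: x sphere_param_in_H3)
  have "norm (integral angles (\<lambda>a. mink (G (sphere_param x r a)) (velocity x r a) * sin (fst a)))
      \<le> integral angles (\<lambda>a. g (sphere_param x r a) * sin (fst a))"
  proof (intro integral_norm_bound_integral integrable_on_sphere x g integrable_continuous c)
    fix a assume a: "a \<in> angles"
    let ?y = "sphere_param x r a"
    have y: "?y \<in> H3" by (rule sphere_param_in_H3[OF x])
    have "\<bar>mink (G ?y) (velocity x r a)\<bar> \<le> riem_norm (G ?y) * riem_norm (velocity x r a)"
      using f[OF y] by (intro tangent_Cauchy_Schwarz[OF y] velocity_unit_tangent x)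
        (simp add: has_gradient_def)
    then have "\<bar>mink (G ?y) (velocity x r a)\<bar> \<le> g ?y"
      using le[OF y] velocity_unit_tangent(2)[OF x, of r a] by simp
    then show "norm (mink (G ?y) (velocity x r a) * sin (fst a)) \<le> g ?y * sin (fst a)"
      using sin_nonneg_angles[OF a] by (simp add: abs_mult mult_right_mono)
  qed
  then show ?thesis
    by (simp add: mean_derivative_def sphere_mean_eq x r divide_right_mono)
qed

text \<open>In the variable \<open>ln z\<close> the left side decays exponentially and beats any
  power. The cube supplies the three decay factors that \<open>sphere_mean_weight_le\<close>
  requires of its integrand.\<close>

lemma powr_le_decay:
  assumes "k > 0" "a > 0"
  shows "\<exists>M>0. \<forall>z\<ge>1. z powr - k \<le> M * decay a (ln z) ^ 3"
proof -
  define m where "m = k / (3 * a)"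
  \<comment> \<open>The choice yields
    \<open>1 + l \<le> c * (1 + m * l) \<le> c * exp (m * l)\<close>; raising this to the power
    \<open>3 * a\<close> turns the exponential into \<open>exp (k * l)\<close>.\<close>
  define c where "c = max 1 (1 / m)"
  have m: "m > 0" and c: "c \<ge> 1" "c * m \<ge> 1"
    using assms by (auto simp: m_def c_def max_def field_simps)
  have "z powr - k \<le> c powr (3 * a) * decay a (ln z) ^ 3" if z: "z \<ge> 1" for z
  proof -
    define l where "l = ln z"
    have l: "l \<ge> 0" using z by (simp add: l_def)
    have "1 + l \<le> c * (1 + m * l)"
      using c l mult_right_mono[of 1 "c * m" l] by (simp add: algebra_simps)
    also have "\<dots> \<le> c * exp (m * l)"
      using c by (intro mult_left_mono) auto
    finally have "(1 + l) powr (3 * a) \<le> (c * exp (m * l)) powr (3 * a)"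
      using l assms by (intro powr_mono2) auto
    also have "\<dots> = c powr (3 * a) * exp (k * l)"
      using c assms by (simp add: powr_mult exp_powr_real m_def)
    finally have "(1 + l) powr (3 * a) * exp (- (k * l)) \<le> c powr (3 * a) * exp (k * l) * exp (- (k * l))"
      by (intro mult_right_mono) auto
    also have "\<dots> = c powr (3 * a)"
      by (simp add: exp_minus)
    finally have "exp (- (k * l)) \<le> c powr (3 * a) / (1 + l) powr (3 * a)"
      using l by (subst pos_le_divide_eq) (simp_all add: mult.commute)
    moreover have "z powr - k = exp (- (k * l))"
      using z by (simp add: powr_def l_def)
    moreover have "decay a l ^ 3 = 1 / (1 + l) powr (3 * a)"
      using l by (simp add: decay_def powr_minus power_inverse powr_power divide_inverse mult.commute)
    ultimately show ?thesis
      by (simp add: l_def)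
  qed
  moreover have "c powr (3 * a) > 0" using c by simp
  ultimately show ?thesis by blast
qed

text \<open>The data and the gradient are all dominated by \<open>h\<close>, so by the formula for
  the derivative of \<open>wave_I\<close> three multiples of the mean of \<open>h\<close> bound the
  solution. That mean falls under the same weighted estimate as the nonlinearity.\<close>

lemma linear_solution_le:
  assumes k: "k > 0" and a: "a > 1"
  shows "\<exists>C>0. \<forall>f G g x t.
    (\<forall>y\<in>H3. has_gradient f (G y) y) \<longrightarrow> continuous_on H3 G \<longrightarrow> continuous_on H3 g \<longrightarrow>
    (\<forall>y\<in>H3. \<bar>f y\<bar> + \<bar>g y\<bar> + riem_norm (G y) \<le> fst y powr (- k - 1)) \<longrightarrow> x \<in> H3 \<longrightarrow>
    \<bar>deriv (\<lambda>s. wave_I s x f) t + wave_I t x g\<bar> \<le> C * (decay a (\<bar>t\<bar> - ln (fst x)) / fst x)"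
proof -
  obtain M where M: "M > 0" "\<And>z. z \<ge> 1 \<Longrightarrow> z powr - k \<le> M * decay a (ln z) ^ 3"
    using powr_le_decay[of k a] k a by force
  define B where "B = M * (12 powr a * (4 + 4 / (a - 1))) * 2"
  have B: "B > 0"
    using M a by (simp add: B_def add_pos_pos)
  define h :: "pt \<Rightarrow> real" where "h = (\<lambda>y. fst y powr (- k - 1))"
  have h: "continuous_on H3 h"
    unfolding h_def by (intro continuous_intros) (use fst_ge_1 in fastforce)
  \<comment> \<open>The data live at time 0, hence \<open>T = r\<close>: the shift
    \<open>r - r\<close> is kept to match \<open>T - r\<close>.\<close>
  have hM: "\<bar>h y\<bar> \<le> M * (decay a (ln (fst y)) ^ 2 * (decay a (r - r - ln (fst y)) / fst y))"
    if "y \<in> H3" for y and r :: real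
  proof -
    have y: "fst y \<ge> 1" by (rule fst_ge_1[OF that])
    have "h y = fst y powr - k / fst y"
      using y by (simp add: h_def powr_diff)
    also have "\<dots> \<le> M * decay a (ln (fst y)) ^ 3 / fst y"
      using M(2)[OF y] y by (intro divide_right_mono) auto
    finally show ?thesis
      using y by (simp add: h_def power3_eq_cube power2_eq_square mult_ac)
  qed
  have mean: "cosh r * sphere_mean r h x \<le> B * (decay a (r - ln (fst x)) / fst x)"
    if x: "x \<in> H3" and r: "r \<ge> 0" for x r
  proof -
    let ?w = "decay a (r - ln (fst x)) / fst x"
    have w: "?w \<ge> 0"
      using fst_ge_1[OF x] decay_pos[of a "r - ln (fst x)"] by simp
    have "cosh r * sphere_mean r h x \<le> cosh r * \<bar>sphere_mean r h x\<bar>"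
      by (intro mult_left_mono) auto
    also have "\<dots> \<le> M * (12 powr a * (4 + 4 / (a - 1))) * (decay a (r - r) + decay a (r - ln (fst x))) * ?w"
      by (rule sphere_mean_weight_le) (use x r a h M hM in auto)
    also have "\<dots> \<le> M * (12 powr a * (4 + 4 / (a - 1))) * 2 * ?w"
      using a M decay_le_1[of a "r - r"] decay_le_1[of a "r - ln (fst x)"]
      by (intro mult_right_mono mult_left_mono w) (auto intro!: mult_nonneg_nonneg add_nonneg_nonneg)
    finally show ?thesis by (simp only: B_def)
  qed
  show ?thesis
  proof (intro exI[of _ "3 * B"] conjI allI impI)
    fix f G g x t
    assume f: "\<forall>y\<in>H3. has_gradient f (G y) y" and G: "continuous_on H3 G"
      and g: "continuous_on H3 g" and x: "x \<in> H3"
      and le: "\<forall>y\<in>H3. \<bar>f y\<bar> + \<bar>g y\<bar> + riem_norm (G y) \<le> fst y powr (- k - 1)"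
    have rn: "riem_norm (G y) \<ge> 0" if "y \<in> H3" for y
      using tangent_nonneg[OF that, of "G y"] f that by (simp add: riem_norm_def has_gradient_def)
    have bounds: "\<bar>f y\<bar> \<le> h y" "\<bar>g y\<bar> \<le> h y" "riem_norm (G y) \<le> h y" if "y \<in> H3" for y
      using le that rn[OF that] by (force simp: h_def)+
    have fc: "continuous_on H3 f"
      unfolding continuous_on_eq_continuous_within using f
      by (auto simp: has_gradient_def intro: has_derivative_continuous)
    let ?m = "sphere_mean \<bar>t\<bar> h x"
    have m: "\<bar>sphere_mean \<bar>t\<bar> f x\<bar> \<le> ?m" "\<bar>sphere_mean \<bar>t\<bar> g x\<bar> \<le> ?m"
      "\<bar>mean_derivative G x \<bar>t\<bar>\<bar> \<le> ?m"
      by (rule abs_sphere_mean_le abs_mean_derivative_le;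
          use x fc g h f G bounds sphere_param_in_H3[OF x] in auto)+
    have sh: "\<bar>sinh t\<bar> \<le> cosh t" "\<bar>sinh \<bar>t\<bar>\<bar> \<le> cosh t" "\<bar>cosh t\<bar> \<le> cosh t" 
      using abs_sinh_le_cosh[of t] abs_sinh_le_cosh[of "\<bar>t\<bar>"] by simp_all
    have "\<bar>deriv (\<lambda>s. wave_I s x f) t + wave_I t x g\<bar>
      \<le> \<bar>cosh t * sphere_mean \<bar>t\<bar> f x\<bar> + \<bar>sinh \<bar>t\<bar> * mean_derivative G x \<bar>t\<bar>\<bar> + \<bar>sinh t * sphere_mean \<bar>t\<bar> g x\<bar>"
    proof -
      have "deriv (\<lambda>s. wave_I s x f) t
          = cosh t * sphere_mean \<bar>t\<bar> f x + sinh \<bar>t\<bar> * mean_derivative G x \<bar>t\<bar>"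
        using f by (intro deriv_wave_I x G) auto
      then show ?thesis
        unfolding wave_I_def[of t] by linarith
    qed
    also have "\<dots> \<le> cosh t * ?m + cosh t * ?m + cosh t * ?m"
      unfolding abs_mult by (intro add_mono mult_mono sh m) auto
    also have "\<dots> = 3 * (cosh \<bar>t\<bar> * ?m)" by simp
    also have "\<dots> \<le> 3 * (B * (decay a (\<bar>t\<bar> - ln (fst x)) / fst x))"
      by (intro mult_left_mono mean x) auto
    finally show "\<bar>deriv (\<lambda>s. wave_I s x f) t + wave_I t x g\<bar>
      \<le> 3 * B * (decay a (\<bar>t\<bar> - ln (fst x)) / fst x)" by simp
  qed (use B in simp)
qed

section \<open>The fixed point\<close>

text \<open>For \<open>\<bar>w\<bar> \<le> \<eta> / z\<close> the logarithm of
  \<open>1 / \<bar>w\<bar>\<close> is at least \<open>L + ln z\<close>. Splitting the exponent as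
  \<open>1 - p = - q - 2 * a\<close> with \<open>q > 0\<close>, one part becomes small for large
  \<open>L\<close> and the other is the squared decay. The mean value inequality then passes from
  the derivative to differences.\<close>

lemma nonlinearity_Lipschitz:
  fixes F :: "real \<Rightarrow> real"
  assumes F: "\<And>u. F differentiable (at u)" and F0: "deriv F 0 = 0" and C: "C > 0" and \<delta>: "\<delta> > 0"
    and F': "\<And>u. 0 < \<bar>u\<bar> \<Longrightarrow> \<bar>u\<bar> < \<delta> \<Longrightarrow> \<bar>deriv F u\<bar> \<le> C * ln (1 / \<bar>u\<bar>) powr (1 - p)"
    and a: "a > 0" "2 * a < p - 1" and \<kappa>: "\<kappa> > 0"
  shows "\<exists>\<eta>>0. \<forall>z\<ge>1. \<forall>u v. \<bar>u\<bar> \<le> \<eta> / z \<longrightarrow> \<bar>v\<bar> \<le> \<eta> / z \<longrightarrow>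
    \<bar>F u - F v\<bar> \<le> \<kappa> * decay a (ln z) ^ 2 * \<bar>u - v\<bar>"
proof -
  define q where "q = p - 1 - 2 * a"
  have q: "q > 0" using a by (simp add: q_def)
  \<comment> \<open>The second entry solves \<open>C * L powr - q = \<kappa>\<close>; the first
    allows \<open>L + l\<close> to be replaced by \<open>1 + l\<close>.\<close>
  define L where "L = max 1 ((C / \<kappa>) powr (1 / q))"
  define \<eta> where "\<eta> = min (exp (- L)) (\<delta> / 2)"
  have \<eta>: "\<eta> > 0" "\<eta> \<le> exp (- L)" "\<eta> < \<delta>"
    using \<delta> by (auto simp: \<eta>_def min_def)
  have L: "L \<ge> 1" by (simp add: L_def)
  have "C * L powr - q \<le> C * ((C / \<kappa>) powr (1 / q)) powr - q"
    using C \<kappa> q by (intro mult_left_mono powr_mono2') (auto simp: L_def)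
  also have "\<dots> = \<kappa>"
    using C \<kappa> q by (simp add: powr_powr powr_minus field_simps)
  finally have CL: "C * L powr - q \<le> \<kappa>" .
  have deriv_le: "\<bar>deriv F w\<bar> \<le> \<kappa> * decay a (ln z) ^ 2" if z: "z \<ge> 1" and w: "\<bar>w\<bar> \<le> \<eta> / z" for z w
  proof (cases "w = 0")
    \<comment> \<open>The logarithmic hypothesis excludes the point 0, where the derivative of
      \<open>F\<close> vanishes.\<close>
    case True
    then show ?thesis using F0 \<kappa> by simp
  next
    case False
    have "\<eta> / z \<le> \<eta>" using z \<eta> by (simp add: field_simps)
    then have "\<bar>w\<bar> < \<delta>" using w \<eta> by linarith
    then have 1: "\<bar>deriv F w\<bar> \<le> C * ln (1 / \<bar>w\<bar>) powr (1 - p)"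
      using F' False by simp
    define l where "l = ln z"
    have l: "l \<ge> 0" using z by (simp add: l_def)
    have "\<bar>w\<bar> \<le> exp (- L) / z"
      using w \<eta>(2) z by (meson divide_right_mono order_trans zero_le_one)
    then have "ln \<bar>w\<bar> \<le> ln (exp (- L) / z)"
      using False by (intro ln_mono) auto
    also have "\<dots> = - L - l"
      using z by (simp add: ln_div l_def)
    finally have ge: "L + l \<le> ln (1 / \<bar>w\<bar>)"
      using False by (simp add: ln_div)
    have "ln (1 / \<bar>w\<bar>) powr (1 - p) \<le> (L + l) powr (1 - p)"
      using ge L l a by (intro powr_mono2') auto
    also have "\<dots> = (L + l) powr - q * (L + l) powr (- 2 * a)"
      by (simp add: q_def flip: powr_add)
    also have "\<dots> \<le> L powr - q * (1 + l) powr (- 2 * a)"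
      using L l q a by (intro mult_mono powr_mono2') auto
    also have "(1 + l) powr (- 2 * a) = decay a l ^ 2"
      using l by (simp add: decay_def powr_power mult.commute)
    finally have "C * ln (1 / \<bar>w\<bar>) powr (1 - p) \<le> (C * L powr - q) * decay a l ^ 2"
      using C by (simp add: mult_left_mono mult.assoc)
    also have "\<dots> \<le> \<kappa> * decay a l ^ 2"
      by (intro mult_right_mono CL) auto
    finally show ?thesis using 1 by (simp add: l_def)
  qed
  have "\<bar>F u - F v\<bar> \<le> \<kappa> * decay a (ln z) ^ 2 * \<bar>u - v\<bar>"
    if z: "z \<ge> 1" and uv: "\<bar>u\<bar> \<le> \<eta> / z" "\<bar>v\<bar> \<le> \<eta> / z" for z u v
  proof -
    have "norm (F u - F v) \<le> \<kappa> * decay a (ln z) ^ 2 * norm (u - v)"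
    proof (rule field_differentiable_bound)
      show "convex {- (\<eta> / z)..\<eta> / z}" by (rule convex_real_interval)
      show "(F has_real_derivative deriv F w) (at w within {- (\<eta> / z)..\<eta> / z})" for w
        using F[of w] by (metis DERIV_deriv_iff_real_differentiable has_field_derivative_at_within)
      show "norm (deriv F w) \<le> \<kappa> * decay a (ln z) ^ 2" if "w \<in> {- (\<eta> / z)..\<eta> / z}" for w
        using deriv_le[OF z, of w] that by (auto simp: abs_le_iff)
    qed (use uv in \<open>auto simp: abs_le_iff\<close>)
    then show ?thesis by simp
  qed
  then show ?thesis using \<eta>(1) by blast
qed

text \<open>Banach's fixed point argument for the weighted sup norm on the ball of radius \<eta>;
  the number \<open>d\<close> plays the role of the distance of \<open>u\<close> and
  \<open>v\<close>. Since \<Phi> is at most 1, weighted convergence is uniform and preserves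
  continuity.\<close>

lemma weighted_contraction_fixpoint:
  fixes T :: "('b::topological_space \<Rightarrow> real) \<Rightarrow> 'b \<Rightarrow> real"
  assumes \<Phi>: "\<And>z. z \<in> S \<Longrightarrow> 0 \<le> \<Phi> z" "\<And>z. z \<in> S \<Longrightarrow> \<Phi> z \<le> 1" and \<eta>: "\<eta> \<ge> 0"
    and cont: "\<And>u. continuous_on S u \<Longrightarrow> continuous_on S (T u)"
    and T0: "\<And>z. z \<in> S \<Longrightarrow> \<bar>T (\<lambda>_. 0) z\<bar> \<le> \<eta> / 2 * \<Phi> z"
    and contr: "\<And>u v d z. continuous_on S u \<Longrightarrow> continuous_on S v \<Longrightarrow>
      (\<And>z. z \<in> S \<Longrightarrow> \<bar>u z\<bar> \<le> \<eta> * \<Phi> z) \<Longrightarrow> (\<And>z. z \<in> S \<Longrightarrow> \<bar>v z\<bar> \<le> \<eta> * \<Phi> z) \<Longrightarrow> d \<ge> 0 \<Longrightarrow>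
      (\<And>z. z \<in> S \<Longrightarrow> \<bar>u z - v z\<bar> \<le> d * \<Phi> z) \<Longrightarrow> z \<in> S \<Longrightarrow> \<bar>T u z - T v z\<bar> \<le> d / 2 * \<Phi> z"
  obtains u where "continuous_on S u" "\<And>z. z \<in> S \<Longrightarrow> T u z = u z"
proof -
  \<comment> \<open>The Picard iterates starting from 0.\<close>
  define U where "U = rec_nat (\<lambda>_. 0) (\<lambda>_. T)"
  have U_0: "U 0 = (\<lambda>_. 0)" and U_Suc: "U (Suc n) = T (U n)" for n
    by (simp_all add: U_def)
  have c: "continuous_on S (U n)" for n
    by (induction n) (auto simp: U_0 U_Suc intro: cont)
  have bound: "\<bar>U n z\<bar> \<le> \<eta> * \<Phi> z" if "z \<in> S" for n z
    using that
  proof (induction n arbitrary: z)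
    case 0
    then show ?case using \<eta> \<Phi> by (simp add: U_0)
  next
    case (Suc n)
    \<comment> \<open>The ball is invariant: the distance to \<open>T 0\<close> uses half of the
      radius and \<open>T 0\<close> itself the other half.\<close>
    have "\<bar>T (U n) z - T (U 0) z\<bar> \<le> \<eta> / 2 * \<Phi> z"
      using Suc by (intro contr c \<eta>) (auto simp: U_0 \<eta> \<Phi>)
    then have "\<bar>T (U n) z - T (U 0) z\<bar> + \<bar>T (U 0) z\<bar> \<le> \<eta> / 2 * \<Phi> z + \<eta> / 2 * \<Phi> z"
      using T0[OF Suc.prems] unfolding U_0 by (rule add_mono)
    then show ?case
      unfolding U_Suc by simp
  qed
  have step: "\<bar>U (Suc n) z - U n z\<bar> \<le> \<eta> * (1 / 2) ^ n * \<Phi> z" if "z \<in> S" for n z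
    using that
  proof (induction n arbitrary: z)
    case 0
    then show ?case using bound[OF 0, of 1] by (simp add: U_0)
  next
    case (Suc n)
    have "\<bar>T (U (Suc n)) z - T (U n) z\<bar> \<le> (\<eta> * (1 / 2) ^ n) / 2 * \<Phi> z"
      using Suc \<eta> by (intro contr c bound) auto
    then show ?case by (simp add: U_Suc)
  qed
  have geo: "\<bar>U (n + m) z - U n z\<bar> \<le> 2 * \<eta> * (1 / 2) ^ n * \<Phi> z" if z: "z \<in> S" for n m z
  proof -
    \<comment> \<open>The exact geometric partial sum makes the induction on \<open>m\<close>
      close.\<close>
    have "\<bar>U (n + m) z - U n z\<bar> \<le> 2 * \<eta> * ((1 / 2) ^ n - (1 / 2) ^ (n + m)) * \<Phi> z"
    proof (induction m)
      case (Suc m)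
      then show ?case
        using step[OF z, of "n + m"] by (simp add: algebra_simps)
    qed simp
    also have "\<dots> \<le> 2 * \<eta> * (1 / 2) ^ n * \<Phi> z"
      using \<eta> \<Phi>[OF z] by (intro mult_right_mono mult_left_mono) auto
    finally show ?thesis .
  qed
  define u where "u = (\<lambda>z. lim (\<lambda>n. U n z))"
  have lim0: "(\<lambda>n. K * (1 / 2) ^ n) \<longlonglongrightarrow> 0" for K :: real
    by (rule tendsto_mult_right_zero) (simp add: LIMSEQ_realpow_zero)
  have lim: "(\<lambda>n. U n z) \<longlonglongrightarrow> u z" if z: "z \<in> S" for z
  proof -
    have "Cauchy (\<lambda>n. U n z)"
    proof (rule CauchyI')
      fix e :: real assume e: "e > 0"
      obtain N where N: "2 * \<eta> * (1 / 2) ^ N < e / 2"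
        using order_tendstoD(2)[OF lim0[of "2 * \<eta>"], of "e / 2"] e
        by (auto simp: eventually_sequentially)
      have "\<bar>U (N + m) z - U N z\<bar> < e / 2" for m
      proof -
        have "2 * \<eta> * (1 / 2) ^ N * \<Phi> z \<le> 2 * \<eta> * (1 / 2) ^ N"
          using \<Phi>[OF z] \<eta> by (intro mult_left_le) auto
        then show ?thesis using geo[OF z, of N m] N by linarith
      qed
      note N' = this
      have "dist (U m z) (U n z) < e" if "m \<ge> N" "n > m" for m n
        using N'[of "m - N"] N'[of "n - N"] that
        by (intro dist_triangle_half_l[of "U m z" "U N z" e "U n z"]) (simp_all add: dist_real_def)
      then show "\<exists>M. \<forall>m\<ge>M. \<forall>n>m. dist (U m z) (U n z) < e" by blast
    qed
    then show ?thesis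
      by (simp add: u_def Cauchy_convergent_iff convergent_LIMSEQ_iff)
  qed
  have near: "\<bar>u z - U n z\<bar> \<le> (2 * \<eta> * (1 / 2) ^ n) * \<Phi> z" if z: "z \<in> S" for n z
  proof (rule tendsto_upperbound)
    show "(\<lambda>m. \<bar>U (n + m) z - U n z\<bar>) \<longlonglongrightarrow> \<bar>u z - U n z\<bar>"
      using LIMSEQ_ignore_initial_segment[OF lim[OF z], of n] by (intro tendsto_intros) (simp add: add.commute)
  qed (auto intro!: always_eventually geo[OF z])
  have u_bound: "\<bar>u z\<bar> \<le> \<eta> * \<Phi> z" if z: "z \<in> S" for z
    by (rule tendsto_upperbound[OF tendsto_rabs[OF lim[OF z]]]) (auto intro!: always_eventually bound[OF z])
  have u_cont: "continuous_on S u"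
  proof (rule uniform_limit_theorem)
    show "uniform_limit S U u sequentially"
    proof (rule uniform_limitI)
      fix e :: real assume e: "e > 0"
      have "\<forall>\<^sub>F n in sequentially. 2 * \<eta> * (1 / 2) ^ n < e"
        by (rule order_tendstoD(2)[OF lim0 e])
      then show "\<forall>\<^sub>F n in sequentially. \<forall>z\<in>S. dist (U n z) (u z) < e"
      proof eventually_elim
        case (elim n)
        have "\<bar>u z - U n z\<bar> < e" if z: "z \<in> S" for z
        proof -
          have "2 * \<eta> * (1 / 2) ^ n * \<Phi> z \<le> 2 * \<eta> * (1 / 2) ^ n"
            using \<Phi>[OF z] \<eta> by (intro mult_left_le) auto
          then show ?thesis using near[OF z, of n] elim by linarith
        qed
        then show ?case by (simp add: dist_real_def abs_minus_commute)
      qed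
    qed
  qed (auto intro!: always_eventually c)
  have "T u z = u z" if z: "z \<in> S" for z
  proof (rule LIMSEQ_unique)
    show "(\<lambda>n. U (Suc n) z) \<longlonglongrightarrow> u z"
      using lim[OF z] by (rule LIMSEQ_Suc)
    \<comment> \<open>The contraction estimate between \<open>U n\<close> and its limit lets
      \<open>T\<close> pass to the limit.\<close>
    have "\<bar>T (U n) z - T u z\<bar> \<le> (2 * \<eta> * (1 / 2) ^ n) / 2 * \<Phi> z" for n
      using near \<eta> by (intro contr c u_cont bound u_bound z) (auto simp: abs_minus_commute)
    then have *: "\<bar>T (U n) z - T u z\<bar> \<le> \<eta> * \<Phi> z * (1 / 2) ^ n" for n
      by (simp add: mult_ac)
    have "(\<lambda>n. T (U n) z - T u z) \<longlonglongrightarrow> 0"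
      by (rule tendsto_rabs_zero_cancel, rule tendsto_sandwich[OF _ _ tendsto_const lim0])
        (auto intro!: * always_eventually)
    then show "(\<lambda>n. U (Suc n) z) \<longlonglongrightarrow> T u z"
      by (simp add: U_Suc LIM_zero_iff)
  qed
  with u_cont show ?thesis by (rule that)
qed

section \<open>Choice of the constants and existence of the global solution\<close>

theorem theorem1p1:
  fixes p k :: real and F :: "real \<Rightarrow> real"
  assumes "p > 3" and "k > 0"
    and "F C1_differentiable_on UNIV" and "F 0 = 0" and "deriv F 0 = 0"
    and "\<exists>C>0. \<exists>\<delta>\<in>{0<..<1}. \<forall>u. 0 < \<bar>u\<bar> \<and> \<bar>u\<bar> < \<delta> \<longrightarrow>
           \<bar>deriv F u\<bar> \<le> C * ln (1 / \<bar>u\<bar>) powr (1 - p)"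
  shows "\<exists>\<epsilon>0>0. \<forall>\<epsilon>. \<bar>\<epsilon>\<bar> < \<epsilon>0 \<longrightarrow>
           (\<forall>u0 u1. C1_on_H3 u0 \<and> continuous_on H3 u1 \<and>
              (\<forall>x\<in>H3. \<bar>u0 x\<bar> + \<bar>u1 x\<bar> + riem_norm (grad u0 x)
                 \<le> cosh (hdist origin x) powr (- k - 1)) \<longrightarrow>
              (\<exists>u. global_weak_solution F \<epsilon> u0 u1 u))"
proof -
  define a where "a = (p + 1) / 4"
  have a: "a > 1" "a > 0" "2 * a < p - 1"
    using assms(1) by (auto simp: a_def)
  \<comment> \<open>The constant of \<open>duhamel_diff_le\<close>. A Lipschitz factor
    \<open>1 / (2 * A)\<close> for the nonlinearity then yields the contraction factor 1/2.\<close>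
  define A where "A = 12 powr a * (4 + 4 / (a - 1)) * (4 / (a - 1))"
  have A: "A > 0" using a by (simp add: A_def add_pos_pos)
  have Fd: "F differentiable (at u)" for u
    using assms(3) by (auto simp: C1_differentiable_on_eq)
  have Fc: "continuous_on UNIV F"
    using Fd by (meson continuous_at_imp_continuous_on differentiable_imp_continuous_within)
  obtain C \<delta> where C: "C > 0" "\<delta> > 0" and F': "\<And>u. 0 < \<bar>u\<bar> \<Longrightarrow> \<bar>u\<bar> < \<delta> \<Longrightarrow>
      \<bar>deriv F u\<bar> \<le> C * ln (1 / \<bar>u\<bar>) powr (1 - p)"
    using assms(6) by (metis greaterThanLessThan_iff)
  obtain \<eta> where \<eta>: "\<eta> > 0" and Lip: "\<And>z u v. z \<ge> 1 \<Longrightarrow> \<bar>u\<bar> \<le> \<eta> / z \<Longrightarrow> \<bar>v\<bar> \<le> \<eta> / z \<Longrightarrow>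
      \<bar>F u - F v\<bar> \<le> 1 / (2 * A) * decay a (ln z) ^ 2 * \<bar>u - v\<bar>"
    using nonlinearity_Lipschitz[OF Fd assms(5) C F' a(2,3), of "1 / (2 * A)"] A by auto
  obtain B where B: "B > 0" and lin: "\<And>f G g x t. \<lbrakk>\<forall>y\<in>H3. has_gradient f (G y) y; continuous_on H3 G;
      continuous_on H3 g; \<forall>y\<in>H3. \<bar>f y\<bar> + \<bar>g y\<bar> + riem_norm (G y) \<le> fst y powr (- k - 1); x \<in> H3\<rbrakk>
      \<Longrightarrow> \<bar>deriv (\<lambda>s. wave_I s x f) t + wave_I t x g\<bar> \<le> B * (decay a (\<bar>t\<bar> - ln (fst x)) / fst x)"
    using linear_solution_le[OF assms(2) a(1)] by blast
  have "\<exists>u. global_weak_solution F \<epsilon> u0 u1 u"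
    if \<epsilon>: "\<bar>\<epsilon>\<bar> < \<eta> / (2 * B)" and u0: "C1_on_H3 u0" and u1: "continuous_on H3 u1"
      and data: "\<forall>x\<in>H3. \<bar>u0 x\<bar> + \<bar>u1 x\<bar> + riem_norm (grad u0 x)
        \<le> cosh (hdist origin x) powr (- k - 1)"
    for \<epsilon> u0 u1
  proof -
    obtain G where G: "\<And>x. x \<in> H3 \<Longrightarrow> has_gradient u0 (G x) x" "continuous_on H3 G"
      using u0 by (auto simp: C1_on_H3_def)
    define \<Phi> :: "real \<times> pt \<Rightarrow> real" where "\<Phi> = (\<lambda>(t, x). decay a (\<bar>t\<bar> - ln (fst x)) / fst x)"
    define E where "E = (\<lambda>(t, x). \<epsilon> * (deriv (\<lambda>s. wave_I s x u0) t + wave_I t x u1))"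
    define T where "T = (\<lambda>v z. E z + duhamel F v z)"
    have E_le: "\<bar>E (t, x)\<bar> \<le> \<eta> / 2 * \<Phi> (t, x)" if x: "x \<in> H3" for t x
    proof -
      have "\<bar>deriv (\<lambda>s. wave_I s x u0) t + wave_I t x u1\<bar> \<le> B * \<Phi> (t, x)"
        unfolding \<Phi>_def case_prod_conv
        \<comment> \<open>Uniqueness of the gradient identifies \<open>grad u0\<close> with
          \<open>G\<close>, and \<open>cosh (hdist origin x)\<close> is \<open>fst x\<close>, so the
          assumption on the data takes the required form.\<close>
        by (rule lin) (use G u1 data x in \<open>auto simp: cosh_hdist_origin grad_eqI[OF _ G(1)]\<close>)
      then have "\<bar>E (t, x)\<bar> \<le> \<eta> / (2 * B) * (B * \<Phi> (t, x))"
        unfolding E_def case_prod_conv abs_mult using \<epsilon> by (intro mult_mono) auto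
      then show ?thesis using B by simp
    qed
    have fc: "continuous_on H3 u0"
      unfolding continuous_on_eq_continuous_within using G(1)
      by (auto simp: has_gradient_def intro: has_derivative_continuous)
    have slice: "continuous_on ((UNIV \<times> H3) \<times> H3) (\<lambda>(z, y). f y)" if "continuous_on H3 f" for f :: "pt \<Rightarrow> real"
      unfolding case_prod_unfold by (intro continuous_on_compose2[OF that] continuous_intros) auto
    \<comment> \<open>Joint continuity of the linear part is read off the explicit formula that
      replaces \<open>deriv\<close>.\<close>
    have "continuous_on (UNIV \<times> H3) (\<lambda>z. \<epsilon> * (cosh (fst z) * sphere_mean \<bar>fst z\<bar> u0 (snd z)
        + sinh \<bar>fst z\<bar> * mean_derivative G (snd z) \<bar>fst z\<bar> + wave_I (fst z) (snd z) u1))"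
      by (intro continuous_intros continuous_on_sphere_mean continuous_on_mean_derivative
          continuous_on_wave_I slice fc u1 G(2)) auto
    then have Ec: "continuous_on (UNIV \<times> H3) E"
      by (rule continuous_on_eq) (auto simp: E_def deriv_wave_I[OF _ G])
    have \<Phi>: "0 \<le> \<Phi> z" "\<Phi> z \<le> 1 / fst (snd z)" "\<Phi> z \<le> 1" if "z \<in> UNIV \<times> H3" for z :: "real \<times> pt"
    proof -
      have X: "fst (snd z) \<ge> 1" using that fst_ge_1 by auto
      have z: "\<Phi> z = decay a (\<bar>fst z\<bar> - ln (fst (snd z))) / fst (snd z)"
        by (simp add: \<Phi>_def case_prod_unfold)
      show "0 \<le> \<Phi> z"
        unfolding z using X by (intro divide_nonneg_nonneg decay_pos[THEN less_imp_le]) auto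
      show "\<Phi> z \<le> 1 / fst (snd z)"
        unfolding z using X a by (intro divide_right_mono decay_le_1) auto
      moreover have "1 / fst (snd z) \<le> 1" using X by simp
      ultimately show "\<Phi> z \<le> 1" by (rule order_trans)
    qed
    obtain u where u: "continuous_on (UNIV \<times> H3) u" "\<And>z. z \<in> UNIV \<times> H3 \<Longrightarrow> T u z = u z"
    proof (rule weighted_contraction_fixpoint[of "UNIV \<times> H3" \<Phi> \<eta> T])
      fix v w :: "real \<times> pt \<Rightarrow> real" and d :: real and z :: "real \<times> pt"
      assume v: "continuous_on (UNIV \<times> H3) v" "\<And>z. z \<in> UNIV \<times> H3 \<Longrightarrow> \<bar>v z\<bar> \<le> \<eta> * \<Phi> z"
        and w: "continuous_on (UNIV \<times> H3) w" "\<And>z. z \<in> UNIV \<times> H3 \<Longrightarrow> \<bar>w z\<bar> \<le> \<eta> * \<Phi> z"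
        and d: "d \<ge> 0" "\<And>z. z \<in> UNIV \<times> H3 \<Longrightarrow> \<bar>v z - w z\<bar> \<le> d * \<Phi> z" and z: "z \<in> UNIV \<times> H3"
      obtain t x where tx: "z = (t, x)" "x \<in> H3" using z by auto
      have dA: "0 \<le> d / (2 * A)" using d A by simp
      have "\<bar>duhamel F v (t, x) - duhamel F w (t, x)\<bar>
          \<le> (d / (2 * A)) * A * (decay a (\<bar>t\<bar> - ln (fst x)) / fst x)"
        unfolding A_def
      proof (rule duhamel_diff_le[OF Fc v(1) w(1) tx(2) a(1)])
        fix t :: real and y assume y: "y \<in> H3"
        then have ty: "(t, y) \<in> UNIV \<times> H3" by simp
        \<comment> \<open>The weight is at most \<open>1 / fst y\<close>, so functions in the ball
          meet the smallness condition of \<open>Lip\<close> with \<open>z = fst y\<close>.\<close>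
        have "\<eta> * \<Phi> (t, y) \<le> \<eta> / fst y"
          using mult_left_mono[OF \<Phi>(2)[OF ty], of \<eta>] \<eta> by simp
        then have "\<bar>F (v (t, y)) - F (w (t, y))\<bar> \<le> 1 / (2 * A) * decay a (ln (fst y)) ^ 2 * \<bar>v (t, y) - w (t, y)\<bar>"
          using v(2)[OF ty] w(2)[OF ty] by (intro Lip fst_ge_1 y) auto
        also have "\<dots> \<le> 1 / (2 * A) * decay a (ln (fst y)) ^ 2 * (d * \<Phi> (t, y))"
          using A by (intro mult_left_mono d(2) ty) auto
        finally show "\<bar>F (v (t, y)) - F (w (t, y))\<bar> \<le> d / (2 * (12 powr a * (4 + 4 / (a - 1)) * (4 / (a - 1))))
            * (decay a (ln (fst y)) ^ 2 * (decay a (\<bar>t\<bar> - ln (fst y)) / fst y))"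
          unfolding A_def[symmetric] by (simp add: \<Phi>_def mult_ac)
      qed (rule dA[unfolded A_def])
      then show "\<bar>T v z - T w z\<bar> \<le> d / 2 * \<Phi> z"
        using A by (simp add: T_def tx \<Phi>_def)
    next
      show "\<bar>T (\<lambda>_. 0) z\<bar> \<le> \<eta> / 2 * \<Phi> z" if "z \<in> UNIV \<times> H3" for z
        using that E_le by (auto simp: T_def duhamel_zero assms(4))
      show "continuous_on (UNIV \<times> H3) (T v)" if "continuous_on (UNIV \<times> H3) v" for v
        unfolding T_def by (intro continuous_intros Ec continuous_on_duhamel Fc that)
    qed (use \<eta> \<Phi> in auto)
    have "global_weak_solution F \<epsilon> u0 u1 (\<lambda>t x. u (t, x))"
      unfolding global_weak_solution_def
    proof (intro conjI allI ballI)
      fix t :: real and x assume x: "x \<in> H3"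
      show "u (t, x) = \<epsilon> * (deriv (\<lambda>s. wave_I s x u0) t + wave_I t x u1)
        + (LBINT \<tau>=0..t. wave_I \<tau> x (\<lambda>y. F (u (t - \<tau>, y))))"
        using u(2)[of "(t, x)"] x by (simp add: T_def E_def duhamel_eq_LBINT[OF Fc u(1)])
    qed (use u in simp)
    then show ?thesis by blast
  qed
  \<comment> \<open>With \<open>B\<close> from the linear bound, \<epsilon> below
    \<open>\<eta> / (2 * B)\<close> keeps the linear part within half of the radius of the
    ball.\<close>
  then show ?thesis
    using \<eta> B by (intro exI[of _ "\<eta> / (2 * B)"]) auto
qed

end
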